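(* Let $\tau=(\tau_1,\dots,\tau_\ell)$ be a tuple of positive integers and let $0\leq k\leq \ell-1$. Let $\hat P_\tau=C\sqcup O$ be the $k$-decomposition and $\hat P_\tau=C'\sqcup O'$ the $(k+1)$-decomposition. Then for every integer $i$ with $2\leq i\leq |\tau|$ there exists an injective map from the set of faces of codimension $i$ of $\mathcal{O}_{C,O}(\tau)$ to the set of faces of codimension $i$ of $\mathcal{O}_{C',O'}(\tau)$.
   Context: Let $\tau=(\tau_1,\dots,\tau_\ell)$ be a tuple of positive integers and $|\tau|=\sum_i\tau_i$. The maximal ranked poset $P_\tau$ has elements $y^i_j$ ($1\le i\le\ell$, $1\le j\le\tau_i$) with $y^i_j<y^{i'}_{j'}$ if and only if $i<i'$; write $Y^i=\{y^i_1,\dots,y^i_{\tau_i}\}$ (the elements of rank $i$). The extended poset $\hat P_\tau=P_\tau\cup\{\hat0,\hat1\}$ has a new minimum $\hat0$ and a new maximum $\hat1$; set $Y^0=\{\hat0\}$, $Y^{\ell+1}=\{\hat1\}$. Write $a\prec b$ for the covering relation. For $0\le k\le \ell$, the $k$-decomposition is $\hat P_\tau=C\sqcup O$ with $C=Y^0\cup\dots\cup Y^k$ and $O=Y^{k+1}\cup\dots\cup Y^{\ell+1}$. The chain-order polytope $\mathcal{O}_{C,O}(\tau)\subseteq\mathbb{R}^{\hat P_\tau}$ is the set of all $x$ satisfying: $x_{\hat0}=0$, $x_{\hat1}=1$; $x_p\ge 0$ for every $p\in C$; $x_a\le x_b$ for all $a,b\in O$ with $a\prec b$ (order inequalities); and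 $x_{p_1}+\dots+x_{p_k}\le x_q$ for all choices $p_i\in Y^i$ ($1\le i\le k$) and $q\in Y^{k+1}$ (chain inequalities). The codimension of a face $F$ of $\mathcal{O}_{C,O}(\tau)$ is $|\tau|-\dim F$. *)

theory Defs
  imports "HOL-Analysis.Analysis" "HOL-Analysis.Finite_Function_Topology"
begin

text \<open>Encoding.  A tuple tau = (tau_1,...,tau_l) is a list of naturals.
  The element y^i_j of P_tau (1 <= i <= l, 1 <= j <= tau_i) is the pair (i,j);
  the new minimum 0hat is (0,1) and the new maximum 1hat is (l+1,1).
  So Y^i = {(i,j) | 1 <= j <= rank_size tau i} for 0 <= i <= l+1.\<close>

definition rank_size :: "nat list \<Rightarrow> nat \<Rightarrow> nat" where
  "rank_size tau i = (if i = 0 \<or> i = length tau + 1 then 1 else tau ! (i - 1))"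

definition Phat :: "nat list \<Rightarrow> (nat \<times> nat) set" where
  "Phat tau = {(i, j). i \<le> length tau + 1 \<and> 1 \<le> j \<and> j \<le> rank_size tau i}"

definition zero_hat :: "nat list \<Rightarrow> nat \<times> nat" where
  "zero_hat tau = (0, 1)"

definition one_hat :: "nat list \<Rightarrow> nat \<times> nat" where
  "one_hat tau = (length tau + 1, 1)"

definition less_hat :: "nat list \<Rightarrow> nat \<times> nat \<Rightarrow> nat \<times> nat \<Rightarrow> bool" where
  "less_hat tau a b \<longleftrightarrow> a \<in> Phat tau \<and> b \<in> Phat tau \<and> fst a < fst b"

definition covers :: "nat list \<Rightarrow> nat \<times> nat \<Rightarrow> nat \<times> nat \<Rightarrow> bool" where
  "covers tau a b \<longleftrightarrow> less_hat tau a b \<and> \<not> (\<exists>c. less_hat tau a c \<and> less_hat tau c b)"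

definition Cpart :: "nat list \<Rightarrow> nat \<Rightarrow> (nat \<times> nat) set" where
  "Cpart tau k = {p \<in> Phat tau. fst p \<le> k}"

definition Opart :: "nat list \<Rightarrow> nat \<Rightarrow> (nat \<times> nat) set" where
  "Opart tau k = {p \<in> Phat tau. k + 1 \<le> fst p}"

text \<open>Points of R^(Phat tau) are represented as finitely supported maps
  (nat x nat) =>0 real vanishing outside Phat tau.\<close>
definition chain_order_polytope :: "nat list \<Rightarrow> nat \<Rightarrow> ((nat \<times> nat) \<Rightarrow>\<^sub>0 real) set" where
  "chain_order_polytope tau k =
    {x. (\<forall>p. p \<notin> Phat tau \<longrightarrow> Poly_Mapping.lookup x p = 0)
      \<and> Poly_Mapping.lookup x (zero_hat tau) = 0
      \<and> Poly_Mapping.lookup x (one_hat tau) = 1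
      \<and> (\<forall>p \<in> Cpart tau k. 0 \<le> Poly_Mapping.lookup x p)
      \<and> (\<forall>a \<in> Opart tau k. \<forall>b \<in> Opart tau k. covers tau a b \<longrightarrow> Poly_Mapping.lookup x a \<le> Poly_Mapping.lookup x b)
      \<and> (\<forall>ps :: nat \<Rightarrow> nat \<times> nat. \<forall>q \<in> Phat tau.
           (\<forall>i \<in> {1..k}. ps i \<in> Phat tau \<and> fst (ps i) = i) \<and> fst q = k + 1 \<longrightarrow>
           (\<Sum>i = 1..k. Poly_Mapping.lookup x (ps i)) \<le> Poly_Mapping.lookup x q)}"

text \<open>Affine dimension, copied from the library definition of aff_dim
  (which is only available for euclidean_space) to arbitrary real vector spaces.\<close>
definition affdim :: "'a::real_vector set \<Rightarrow> int" where
  "affdim V =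
    (SOME d :: int. \<exists>B. affine hull B = affine hull V \<and> \<not> affine_dependent B \<and> of_nat (card B) = d + 1)"

definition faces_of_codim :: "nat list \<Rightarrow> nat \<Rightarrow> nat \<Rightarrow> ((nat \<times> nat) \<Rightarrow>\<^sub>0 real) set set" where
  "faces_of_codim tau k i =
    {F. F face_of chain_order_polytope tau k \<and> int (sum_list tau) - affdim F = int i}"

end

theory Submission
  imports Defs
begin

text \<open>A nonempty face of a polyhedron is determined by the set of inequalities that are tight at one
of its relatively interior points, so a face is recorded by the tightness pattern of a point.  Write
\<open>Y\<close>, \<open>W\<close> for the ranks \<open>k + 1\<close>, \<open>k + 2\<close>, let \<open>s\<close> be the largest chain sum over the
ranks \<open>1, \<dots>, k\<close>, let \<open>u\<close> be the minimum over \<open>W\<close>.  The polytopes for \<open>k\<close> and \<open>k + 1\<close>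
differ only in \<open>s \<le> x\<^sub>a \<le> u\<close> versus \<open>0 \<le> x\<^sub>a\<close> and \<open>s + x\<^sub>a \<le> u\<close> for \<open>a\<close> in \<open>Y\<close>, and both
\<open>x\<^sub>a \<mapsto> x\<^sub>a - s\<close> and \<open>x\<^sub>a \<mapsto> u - x\<^sub>a\<close> translate one into the other.

The set of maximal chains is visible in the pattern for \<open>k\<close> iff some \<open>x\<^sub>a = s\<close>, and in the
image of the first map iff some \<open>x\<^sub>a = u\<close>.  Hence the first map is used except when \<open>s\<close> is
attained, \<open>u\<close> is not, and the set of maximal chains is not the canonical one for the given zeros;
then the second map is used.  Where a piece of information becomes visible only in the image, the
point is first moved inside its face so that this piece is canonical and imposes no new equation.
On the affine hull of the face the chosen map is linear and invertible, hence preserves dimension.\<close>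

section \<open>Faces of polyhedra and tight constraints\<close>

definition affine_fun :: "('a::real_vector \<Rightarrow> real) \<Rightarrow> bool" where
  "affine_fun g \<longleftrightarrow> (\<forall>x y t. g ((1 - t) *\<^sub>R x + t *\<^sub>R y) = (1 - t) * g x + t * g y)"

lemma affine_funD: "affine_fun g \<Longrightarrow> g ((1 - t) *\<^sub>R x + t *\<^sub>R y) = (1 - t) * g x + t * g y"
  by (simp add: affine_fun_def)

definition polyhedron_in :: "'a set \<Rightarrow> ('a \<Rightarrow> real) set \<Rightarrow> 'a set" where
  "polyhedron_in V G = {x \<in> V. \<forall>g\<in>G. 0 \<le> g x}"

text \<open>This is the smallest face containing \<open>x\<close>, the one with \<open>x\<close> in
  its relative interior. Dropping the inequalities, as in \<open>tight_hull\<close>, gives its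
  affine hull.\<close>

definition tight_face :: "'a set \<Rightarrow> ('a \<Rightarrow> real) set \<Rightarrow> 'a \<Rightarrow> 'a set" where
  "tight_face V G x = {y \<in> polyhedron_in V G. \<forall>g\<in>G. g x = 0 \<longrightarrow> g y = 0}"

definition tight_hull :: "'a set \<Rightarrow> ('a \<Rightarrow> real) set \<Rightarrow> 'a \<Rightarrow> 'a set" where
  "tight_hull V G x = {y \<in> V. \<forall>g\<in>G. g x = 0 \<longrightarrow> g y = 0}"

lemma mem_affine_combination:
  fixes x y :: "'a::real_vector"
  assumes "affine V" "x \<in> V" "y \<in> V"
  shows "(1 - t) *\<^sub>R x + t *\<^sub>R y \<in> V"
  using assms by (simp add: mem_affine)

text \<open>Each point lies in its own tight face, so equality of the faces transfers the tight
  constraints in both directions.\<close>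

lemma tight_face_eq_iff:
  assumes "x \<in> polyhedron_in V G" "x' \<in> polyhedron_in V G"
  shows "tight_face V G x = tight_face V G x' \<longleftrightarrow> (\<forall>g\<in>G. g x = 0 \<longleftrightarrow> g x' = 0)"
proof
  assume "tight_face V G x = tight_face V G x'"
  moreover have "x \<in> tight_face V G x" "x' \<in> tight_face V G x'"
    using assms by (auto simp: tight_face_def)
  ultimately have "x \<in> tight_face V G x'" "x' \<in> tight_face V G x"
    by auto
  then show "\<forall>g\<in>G. g x = 0 \<longleftrightarrow> g x' = 0"
    by (auto simp: tight_face_def)
qed (auto simp: tight_face_def)

text \<open>Slacks vanishing at \<open>x\<close> vanish along the whole line through
  \<open>x\<close> and \<open>y\<close>. The finitely many others are positive at \<open>x\<close>
  and stay so nearby by continuity. Negative \<open>t\<close> matters later: it leads beyond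
  \<open>x\<close>, away from \<open>y\<close>.\<close>

lemma polyhedron_in_extend:
  fixes x y :: "'a::real_vector"
  assumes V: "affine V" and G: "finite G" "\<And>g. g \<in> G \<Longrightarrow> affine_fun g"
    and x: "x \<in> polyhedron_in V G" and y: "y \<in> V" "\<forall>g\<in>G. g x = 0 \<longrightarrow> g y = 0"
  obtains e where "0 < e" "\<And>t. \<bar>t\<bar> \<le> e \<Longrightarrow> (1 - t) *\<^sub>R x + t *\<^sub>R y \<in> polyhedron_in V G"
proof -
  have "\<forall>\<^sub>F t in nhds 0. 0 \<le> g ((1 - t) *\<^sub>R x + t *\<^sub>R y)" if g: "g \<in> G" for g
  proof (cases "g x = 0")
    case True
    then show ?thesis
      using g y G by (auto simp: affine_funD)
  next
    case False
    with x g have "0 < g x"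
      by (auto simp: polyhedron_in_def less_le)
    moreover have "((\<lambda>t. (1 - t) * g x + t * g y) \<longlongrightarrow> (1 - 0) * g x + 0 * g y) (nhds 0)"
      by (intro tendsto_intros filterlim_ident)
    ultimately have "\<forall>\<^sub>F t in nhds 0. 0 < (1 - t) * g x + t * g y"
      by (auto dest: order_tendstoD)
    then show ?thesis
      by eventually_elim (simp add: affine_funD G g)
  qed
  then have "\<forall>\<^sub>F t in nhds 0. \<forall>g\<in>G. 0 \<le> g ((1 - t) *\<^sub>R x + t *\<^sub>R y)"
    using G by (simp add: eventually_ball_finite)
  then obtain d where d: "0 < d"
    "\<And>t::real. dist t 0 < d \<Longrightarrow> \<forall>g\<in>G. 0 \<le> g ((1 - t) *\<^sub>R x + t *\<^sub>R y)"
    by (auto simp: eventually_nhds_metric)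
  show thesis
  proof (rule that)
    show "0 < d / 2"
      using d by simp
    fix t :: real
    assume "\<bar>t\<bar> \<le> d / 2"
    with d have "dist t 0 < d"
      by simp
    moreover have "(1 - t) *\<^sub>R x + t *\<^sub>R y \<in> V"
      using V x y by (intro mem_affine_combination) (auto simp: polyhedron_in_def)
    ultimately show "(1 - t) *\<^sub>R x + t *\<^sub>R y \<in> polyhedron_in V G"
      using d by (auto simp: polyhedron_in_def)
  qed
qed

lemma affine_tight_hull:
  fixes x :: "'a::real_vector"
  assumes V: "affine V" and G: "\<And>g. g \<in> G \<Longrightarrow> affine_fun g"
  shows "affine (tight_hull V G x)"
  unfolding affine_alt
proof (intro ballI allI)
  fix a b t
  assume ab: "a \<in> tight_hull V G x" "b \<in> tight_hull V G x"
  then have "(1 - t) *\<^sub>R a + t *\<^sub>R b \<in> V"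
    using V by (intro mem_affine_combination) (auto simp: tight_hull_def)
  with ab show "(1 - t) *\<^sub>R a + t *\<^sub>R b \<in> tight_hull V G x"
    using G by (auto simp: tight_hull_def affine_funD)
qed

text \<open>A short step from \<open>x\<close> towards a point \<open>y\<close> of the hull ends at
  a point \<open>w\<close> of the face, and \<open>y\<close> is recovered as an affine combination
  of \<open>x\<close> and \<open>w\<close> with coefficient \<open>1 / e\<close>.\<close>

lemma affine_hull_tight_face:
  fixes x :: "'a::real_vector"
  assumes V: "affine V" and G: "finite G" "\<And>g. g \<in> G \<Longrightarrow> affine_fun g"
    and x: "x \<in> polyhedron_in V G"
  shows "affine hull (tight_face V G x) = tight_hull V G x"
proof
  show "affine hull (tight_face V G x) \<subseteq> tight_hull V G x"
    using affine_tight_hull[OF V G(2)]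
    by (intro hull_minimal) (auto simp: tight_face_def tight_hull_def polyhedron_in_def)
next
  show "tight_hull V G x \<subseteq> affine hull (tight_face V G x)"
  proof
    fix y
    assume y: "y \<in> tight_hull V G x"
    then obtain e where e: "0 < e"
      "\<And>t. \<bar>t\<bar> \<le> e \<Longrightarrow> (1 - t) *\<^sub>R x + t *\<^sub>R y \<in> polyhedron_in V G"
      using polyhedron_in_extend[OF V G x] by (auto simp: tight_hull_def)
    define w where "w = (1 - e) *\<^sub>R x + e *\<^sub>R y"
    have "w \<in> tight_face V G x"
      using e(2)[of e] e(1) y G by (auto simp: w_def tight_face_def tight_hull_def affine_funD)
    moreover have "x \<in> tight_face V G x"
      using x by (auto simp: tight_face_def)
    ultimately have "(1 - 1 / e) *\<^sub>R x + (1 / e) *\<^sub>R w \<in> affine hull (tight_face V G x)"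
      by (intro mem_affine_combination affine_affine_hull hull_inc)
    moreover have "(1 - 1 / e) *\<^sub>R x + (1 / e) *\<^sub>R w = y"
      using e(1) by (simp add: w_def algebra_simps flip: scaleR_add_left)
    ultimately show "y \<in> affine hull (tight_face V G x)"
      by simp
  qed
qed

text \<open>An affine function that is nonnegative at both ends of a segment and zero at an inner
  point is zero at both ends.\<close>

lemma tight_face_face_of:
  fixes x :: "'a::real_vector"
  assumes V: "affine V" and G: "\<And>g. g \<in> G \<Longrightarrow> affine_fun g"
  shows "tight_face V G x face_of polyhedron_in V G"
  unfolding face_of_def
proof (intro conjI ballI impI)
  show "tight_face V G x \<subseteq> polyhedron_in V G"
    by (auto simp: tight_face_def)
  show "convex (tight_face V G x)"
    unfolding convex_alt
  proof (intro ballI allI impI)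
    fix a b and t :: real
    assume a: "a \<in> tight_face V G x" and b: "b \<in> tight_face V G x" and t: "0 \<le> t \<and> t \<le> 1"
    then have "(1 - t) *\<^sub>R a + t *\<^sub>R b \<in> V"
      using V by (intro mem_affine_combination) (auto simp: tight_face_def polyhedron_in_def)
    with a b t show "(1 - t) *\<^sub>R a + t *\<^sub>R b \<in> tight_face V G x"
      using G by (auto simp: tight_face_def polyhedron_in_def affine_funD)
  qed
next
  fix a b z
  assume a: "a \<in> polyhedron_in V G" and b: "b \<in> polyhedron_in V G"
    and z: "z \<in> tight_face V G x" and seg: "z \<in> open_segment a b"
  from seg obtain t where t: "0 < t" "t < 1" "z = (1 - t) *\<^sub>R a + t *\<^sub>R b"
    by (auto simp: in_segment)
  have "g a = 0 \<and> g b = 0" if g: "g \<in> G" "g x = 0" for g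
  proof -
    have "(1 - t) * g a + t * g b = 0"
      using z t g G affine_funD[of g t a b] by (auto simp: tight_face_def)
    moreover have "0 \<le> (1 - t) * g a" "0 \<le> t * g b"
      using a b g t by (auto simp: polyhedron_in_def)
    ultimately show ?thesis
      using t by (simp add: add_nonneg_eq_0_iff)
  qed
  with a b show "a \<in> tight_face V G x" "b \<in> tight_face V G x"
    by (auto simp: tight_face_def)
qed

text \<open>A point of \<open>F\<close> with the fewest tight constraints serves as relatively
  interior point.\<close>

lemma face_of_polyhedron_in_tight:
  fixes F :: "'a::real_vector set"
  assumes V: "affine V" and G: "finite G" "\<And>g. g \<in> G \<Longrightarrow> affine_fun g"
    and F: "F face_of polyhedron_in V G" "F \<noteq> {}"
  obtains x where "x \<in> polyhedron_in V G" "F = tight_face V G x"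
proof -
  obtain x where x: "x \<in> F"
    and min: "\<And>y. y \<in> F \<Longrightarrow> card {g\<in>G. g x = 0} \<le> card {g\<in>G. g y = 0}"
    using F(2) ex_has_least_nat[of "\<lambda>x. x \<in> F" _ "\<lambda>x. card {g\<in>G. g x = 0}"] by blast
  have sub: "F \<subseteq> polyhedron_in V G"
    using F by (auto simp: face_of_def)
  have "F \<subseteq> tight_face V G x"
  proof
    fix y
    assume y: "y \<in> F"
    \<comment> \<open>The midpoint is tight only where both \<open>x\<close> and \<open>y\<close>
      are, so minimality at \<open>x\<close> makes every constraint tight at \<open>x\<close> tight
      at \<open>y\<close>.\<close>
    define w where "w = (1 - 1/2) *\<^sub>R x + (1/2) *\<^sub>R y"
    have "w \<in> F"
      unfolding w_def using F(1) x y by (intro convexD_alt face_of_imp_convex) auto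
    have w: "g w = 0 \<longleftrightarrow> g x = 0 \<and> g y = 0" if g: "g \<in> G" for g
    proof -
      have "g w = (1 - 1/2) * g x + (1/2) * g y"
        unfolding w_def using G(2)[OF g] by (rule affine_funD)
      moreover have "0 \<le> g x" "0 \<le> g y"
        using sub x y g by (auto simp: polyhedron_in_def)
      ultimately show ?thesis
        by auto
    qed
    have "{g\<in>G. g w = 0} = {g\<in>G. g x = 0}"
      using min[OF \<open>w \<in> F\<close>] G by (intro card_seteq) (auto simp: w)
    then have "\<forall>g\<in>G. g x = 0 \<longrightarrow> g y = 0"
      using w by blast
    with y sub show "y \<in> tight_face V G x"
      by (auto simp: tight_face_def)
  qed
  moreover have "tight_face V G x \<subseteq> F"
  proof
    fix y
    assume y: "y \<in> tight_face V G x"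
    then obtain e where e: "0 < e"
      "\<And>t. \<bar>t\<bar> \<le> e \<Longrightarrow> (1 - t) *\<^sub>R x + t *\<^sub>R y \<in> polyhedron_in V G"
      using polyhedron_in_extend[OF V G, of x y] sub x
      by (auto simp: tight_face_def polyhedron_in_def)
    \<comment> \<open>Extending the segment from \<open>y\<close> slightly past \<open>x\<close>
      puts \<open>x\<close> strictly between \<open>y\<close> and \<open>w\<close>, and the face
      property then draws \<open>y\<close> into \<open>F\<close>.\<close>
    define w where "w = (1 + e) *\<^sub>R x - e *\<^sub>R y"
    have w: "w \<in> polyhedron_in V G"
      using e(2)[of "-e"] e(1) by (simp add: w_def)
    show "y \<in> F"
    proof (cases "x = y")
      case False
      have "w - y = (1 + e) *\<^sub>R (x - y)"
        by (simp add: w_def algebra_simps)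
      with False e have "w \<noteq> y"
        by auto
      have "x = (1 - 1 / (1 + e)) *\<^sub>R y + (1 / (1 + e)) *\<^sub>R w"
      proof -
        have "(1 - 1 / (1 + e)) *\<^sub>R y = (e / (1 + e)) *\<^sub>R y"
          using e by (simp add: field_simps)
        moreover have "(1 / (1 + e)) *\<^sub>R w = x - (e / (1 + e)) *\<^sub>R y"
          using e by (simp add: w_def scaleR_diff_right)
        ultimately show ?thesis
          by simp
      qed
      then have "x \<in> open_segment y w"
        using \<open>w \<noteq> y\<close> e(1)
        unfolding in_segment by (intro conjI exI[of _ "1 / (1 + e)"]) auto
      then show ?thesis
        using face_ofD[OF F(1)] x y w by (auto simp: tight_face_def)
    qed (use x in simp)
  qed
  ultimately show thesis
    using that x sub by blast
qed

section \<open>Affine dimension under linear bijections\<close>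

lemma affine_hull_image_linear:
  assumes "linear h"
  shows "affine hull (h ` S) = h ` (affine hull S)"
proof
  have comb: "h ((1 - t) *\<^sub>R x + t *\<^sub>R y) = (1 - t) *\<^sub>R h x + t *\<^sub>R h y" for x y t
    using assms by (simp add: linear_add linear_scale)
  have "affine (h ` (affine hull S))"
    by (intro affine_alt[THEN iffD2]) (auto simp: comb[symmetric] intro!: imageI mem_affine_combination affine_affine_hull)
  then show "affine hull (h ` S) \<subseteq> h ` (affine hull S)"
    by (intro hull_minimal image_mono hull_subset)
  have "affine (h -` (affine hull (h ` S)))"
    by (intro affine_alt[THEN iffD2]) (auto simp: comb intro!: mem_affine_combination affine_affine_hull)
  then have "affine hull S \<subseteq> h -` (affine hull (h ` S))"
    by (intro hull_minimal) (auto intro: hull_inc)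
  then show "h ` (affine hull S) \<subseteq> affine hull (h ` S)"
    by auto
qed

lemma affine_dependent_image_linear:
  assumes "linear h" "inj h"
  shows "affine_dependent (h ` S) \<longleftrightarrow> affine_dependent S"
proof -
  have "h ` S - {h x} = h ` (S - {x})" for x
    using assms by (auto simp: inj_eq)
  then show ?thesis
    using assms by (simp add: affine_dependent_def affine_hull_image_linear inj_image_mem_iff)
qed

lemma affdim_affine_hull: "affdim (affine hull S) = affdim S"
  by (simp add: affdim_def hull_hull)

text \<open>The predicate under \<open>SOME\<close> in \<open>affdim\<close> is itself invariant, so neither existence nor
uniqueness of the dimension is needed.\<close>

lemma affdim_image_linear:
  fixes h :: "'a::real_vector \<Rightarrow> 'b::real_vector"
  assumes h: "linear h" "bij h"
  shows "affdim (h ` S) = affdim S"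
proof -
  have "(\<exists>B. affine hull B = affine hull (h ` S) \<and> \<not> affine_dependent B \<and> of_nat (card B) = d + 1)
    \<longleftrightarrow> (\<exists>B. affine hull B = affine hull S \<and> \<not> affine_dependent B \<and> of_nat (card B) = d + 1)"
    (is "?L \<longleftrightarrow> ?R") for d :: int
  proof -
    have inj: "inj h"
      using h by (simp add: bij_def)
    have card: "card (h ` B) = card B" for B
      using inj by (intro card_image) (auto intro: inj_on_subset)
    have "?L \<longleftrightarrow> (\<exists>B. affine hull (h ` B) = affine hull (h ` S) \<and> \<not> affine_dependent (h ` B)
      \<and> of_nat (card (h ` B)) = d + 1)"
      using h(2) by (metis bij_is_surj subset_UNIV subset_imageE)
    also have "\<dots> \<longleftrightarrow> ?R"
      using inj h(1)
      by (simp add: affine_hull_image_linear affine_dependent_image_linear inj_image_eq_iff card)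
    finally show ?thesis .
  qed
  then show ?thesis
    by (simp add: affdim_def)
qed

text \<open>This gives the empty face codimension \<open>sum_list tau + 1\<close>, so it lies
  outside the range of codimensions considered.\<close>

lemma affdim_empty: "affdim {} = -1"
proof -
  have "(\<lambda>d::int. \<exists>B::'a set. affine hull B = affine hull {} \<and> \<not> affine_dependent B
      \<and> of_nat (card B) = d + 1) = (\<lambda>d. d = -1)"
    by (auto simp: affine_dependent_def)
  then show ?thesis
    unfolding affdim_def by simp
qed

section \<open>The polytopes as systems of inequalities\<close>

lemma finite_argmax:
  fixes f :: "'a \<Rightarrow> real"
  assumes "finite A" "A \<noteq> {}"
  obtains p where "p \<in> A" "\<And>q. q \<in> A \<Longrightarrow> f q \<le> f p"
proof -
  have "Max (f ` A) \<in> f ` A"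
    using assms by (intro Max_in) auto
  then obtain p where "p \<in> A" "f p = Max (f ` A)"
    by auto
  with assms show thesis
    using that[of p] by simp
qed

lemma finite_argmin:
  fixes f :: "'a \<Rightarrow> real"
  assumes "finite A" "A \<noteq> {}"
  obtains p where "p \<in> A" "\<And>q. q \<in> A \<Longrightarrow> f p \<le> f q"
  using finite_argmax[OF assms, of "\<lambda>p. - f p"] by auto

lemma lookup_scaleR:
  "Poly_Mapping.lookup (r *\<^sub>R z) p = r * Poly_Mapping.lookup z p" for z :: "'a \<Rightarrow>\<^sub>0 real"
proof -
  have "finite {p. r *\<^sub>R Poly_Mapping.lookup z p \<noteq> 0}"
    by (rule finite_subset[OF _ finite_lookup[of z]]) auto
  then show ?thesis
    by (simp add: scaleR_poly_mapping_def Abs_poly_mapping_inverse)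
qed

text \<open>For finite \<open>A\<close> the support stays finite, so the abstraction is meaningful.
  All coordinate changes below have this form.\<close>

definition overwrite :: "'a set \<Rightarrow> ('a \<Rightarrow> real) \<Rightarrow> ('a \<Rightarrow>\<^sub>0 real) \<Rightarrow> ('a \<Rightarrow>\<^sub>0 real)" where
  "overwrite A f z = Abs_poly_mapping (\<lambda>p. if p \<in> A then f p else Poly_Mapping.lookup z p)"

lemma lookup_overwrite:
  assumes "finite A"
  shows "Poly_Mapping.lookup (overwrite A f z) p = (if p \<in> A then f p else Poly_Mapping.lookup z p)"
proof -
  have "finite {p. (if p \<in> A then f p else Poly_Mapping.lookup z p) \<noteq> 0}"
    by (rule finite_subset[OF _ finite_UnI[OF assms finite_lookup[of z]]]) auto
  then show ?thesis
    by (simp add: overwrite_def Abs_poly_mapping_inverse)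
qed

lemma linear_overwrite:
  fixes c :: "('a \<Rightarrow>\<^sub>0 real) \<Rightarrow> 'a \<Rightarrow> real"
  assumes "finite A" "\<And>q. linear (\<lambda>z. c z q)"
  shows "linear (\<lambda>z. overwrite A (c z) z)"
  using assms linear_add[OF assms(2)] linear_scale[OF assms(2)]
  by (intro linearI poly_mapping_eqI) (auto simp: lookup_overwrite lookup_add lookup_scaleR)

lemma linear_lookup: "linear (\<lambda>z :: 'a \<Rightarrow>\<^sub>0 real. Poly_Mapping.lookup z p)"
  by (intro linearI) (auto simp: lookup_add lookup_scaleR)

locale maximal_ranked =
  fixes tau :: "nat list"
  assumes pos: "\<forall>t\<in>set tau. 0 < t"
begin

abbreviation lk :: "(nat \<times> nat \<Rightarrow>\<^sub>0 real) \<Rightarrow> nat \<times> nat \<Rightarrow> real" where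
  "lk \<equiv> Poly_Mapping.lookup"

definition rk :: "nat \<Rightarrow> (nat \<times> nat) set" where
  "rk r = {p \<in> Phat tau. fst p = r}"

definition low :: "nat \<Rightarrow> (nat \<times> nat) set" where
  "low j = {p \<in> Phat tau. fst p \<le> j}"

definition steps :: "nat \<Rightarrow> ((nat \<times> nat) \<times> (nat \<times> nat)) set" where
  "steps j = {(a, b). a \<in> Phat tau \<and> b \<in> Phat tau \<and> j < fst a \<and> fst b = Suc (fst a)}"

definition selection :: "nat \<Rightarrow> (nat \<Rightarrow> nat \<times> nat) \<Rightarrow> bool" where
  "selection j ps \<longleftrightarrow> (\<forall>i\<in>{1..j}. ps i \<in> rk i)"

definition csum :: "nat \<Rightarrow> (nat \<Rightarrow> nat \<times> nat) \<Rightarrow> (nat \<times> nat \<Rightarrow>\<^sub>0 real) \<Rightarrow> real" where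
  "csum j ps z = (\<Sum>i=1..j. lk z (ps i))"

definition affspace :: "(nat \<times> nat \<Rightarrow>\<^sub>0 real) set" where
  "affspace = {z. (\<forall>p. p \<notin> Phat tau \<longrightarrow> lk z p = 0) \<and> lk z (zero_hat tau) = 0 \<and> lk z (one_hat tau) = 1}"

definition slacks :: "nat \<Rightarrow> ((nat \<times> nat \<Rightarrow>\<^sub>0 real) \<Rightarrow> real) set" where
  "slacks j = (\<lambda>p z. lk z p) ` low j
     \<union> (\<lambda>(a, b) z. lk z b - lk z a) ` steps j
     \<union> (\<lambda>(ps, q) z. lk z q - csum j ps z) ` (Collect (selection j) \<times> rk (Suc j))"

lemma rank_size_pos: "r \<le> Suc (length tau) \<Longrightarrow> 0 < rank_size tau r"
  using pos by (auto simp: rank_size_def)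

lemma first_in_rk: "r \<le> Suc (length tau) \<Longrightarrow> (r, 1) \<in> rk r"
  using rank_size_pos[of r] by (auto simp: rk_def Phat_def)

lemma finite_Phat: "finite (Phat tau)"
proof -
  have "Phat tau \<subseteq> (SIGMA i:{..length tau + 1}. {1..rank_size tau i})"
    by (auto simp: Phat_def)
  then show ?thesis
    by (rule finite_subset) auto
qed

lemma finite_rk: "finite (rk r)" and finite_low: "finite (low j)" and finite_steps: "finite (steps j)"
proof -
  show "finite (rk r)" "finite (low j)"
    using finite_Phat by (auto simp: rk_def low_def)
  have "steps j \<subseteq> Phat tau \<times> Phat tau"
    by (auto simp: steps_def)
  then show "finite (steps j)"
    using finite_Phat by (blast intro: finite_subset)
qed

lemma one_hat_iff: "p \<in> rk (Suc (length tau)) \<longleftrightarrow> p = one_hat tau"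
  by (cases p) (auto simp: rk_def Phat_def one_hat_def rank_size_def)

text \<open>Positivity of \<open>tau\<close> makes every rank nonempty, so a gap of two or more
  ranks always contains an intermediate element.\<close>

lemma covers_iff: "covers tau a b \<longleftrightarrow> a \<in> Phat tau \<and> b \<in> Phat tau \<and> fst b = Suc (fst a)"
proof
  assume "covers tau a b"
  then have ab: "a \<in> Phat tau" "b \<in> Phat tau" "fst a < fst b"
    and none: "\<not> (\<exists>c. less_hat tau a c \<and> less_hat tau c b)"
    by (auto simp: covers_def less_hat_def)
  have "\<not> Suc (fst a) < fst b"
  proof
    assume "Suc (fst a) < fst b"
    with ab first_in_rk[of "Suc (fst a)"]
    have "less_hat tau a (Suc (fst a), 1) \<and> less_hat tau (Suc (fst a), 1) b"
      by (auto simp: less_hat_def rk_def Phat_def)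
    with none show False
      by blast
  qed
  with ab show "a \<in> Phat tau \<and> b \<in> Phat tau \<and> fst b = Suc (fst a)"
    by simp
qed (auto simp: covers_def less_hat_def)

text \<open>The predicate \<open>Q\<close> on slack functions is arbitrary, so that one case
  distinction serves membership, affinity and both tightness relations.\<close>

lemma ball_slacks:
  "(\<forall>g\<in>slacks j. Q g) \<longleftrightarrow> (\<forall>p\<in>low j. Q (\<lambda>z. lk z p))
    \<and> (\<forall>(a, b)\<in>steps j. Q (\<lambda>z. lk z b - lk z a))
    \<and> (\<forall>ps. selection j ps \<longrightarrow> (\<forall>q\<in>rk (Suc j). Q (\<lambda>z. lk z q - csum j ps z)))"
  by (auto simp: slacks_def ball_Un)

lemma chain_order_polytope_eq:
  "chain_order_polytope tau j = polyhedron_in affspace (slacks j)"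
proof -
  have "x \<in> chain_order_polytope tau j \<longleftrightarrow> x \<in> polyhedron_in affspace (slacks j)" for x
  proof -
    have 1: "(\<forall>p\<in>Cpart tau j. 0 \<le> lk x p) \<longleftrightarrow> (\<forall>p\<in>low j. 0 \<le> lk x p)"
      by (auto simp: Cpart_def low_def)
    have 2: "(\<forall>a\<in>Opart tau j. \<forall>b\<in>Opart tau j. covers tau a b \<longrightarrow> lk x a \<le> lk x b)
      \<longleftrightarrow> (\<forall>(a, b)\<in>steps j. 0 \<le> lk x b - lk x a)"
      by (auto simp: Opart_def covers_iff steps_def)
    have sel: "(\<forall>i\<in>{1..j}. ps i \<in> Phat tau \<and> fst (ps i) = i) \<longleftrightarrow> selection j ps" for ps
      by (simp add: selection_def rk_def)
    have 3: "(\<forall>ps. \<forall>q\<in>Phat tau. (\<forall>i\<in>{1..j}. ps i \<in> Phat tau \<and> fst (ps i) = i) \<and> fst q = j + 1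
        \<longrightarrow> (\<Sum>i=1..j. lk x (ps i)) \<le> lk x q)
      \<longleftrightarrow> (\<forall>ps. selection j ps \<longrightarrow> (\<forall>q\<in>rk (Suc j). 0 \<le> lk x q - csum j ps x))"
      unfolding sel by (auto simp: rk_def csum_def)
    show ?thesis
      unfolding chain_order_polytope_def polyhedron_in_def affspace_def ball_slacks mem_Collect_eq 1 2 3
      by (simp only: conj_assoc)
  qed
  then show ?thesis
    by blast
qed

lemma csum_Suc: "csum (Suc j) ps z = csum j ps z + lk z (ps (Suc j))"
  by (simp add: csum_def)

lemma csum_cong: "(\<And>i. i \<in> {1..j} \<Longrightarrow> ps i = ps' i) \<Longrightarrow> csum j ps = csum j ps'"
  by (auto simp: csum_def fun_eq_iff intro!: sum.cong)

lemma selection_Suc: "selection (Suc j) ps \<longleftrightarrow> selection j ps \<and> ps (Suc j) \<in> rk (Suc j)"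
  by (auto simp: selection_def atLeastAtMostSuc_conv)

lemma selection_cong: "(\<And>i. i \<in> {1..j} \<Longrightarrow> ps i = ps' i) \<Longrightarrow> selection j ps = selection j ps'"
  by (simp add: selection_def)

text \<open>Selections are arbitrary outside \<open>{1..j}\<close>, hence infinite in number, but a
  chain sum sees only the restriction to \<open>{1..j}\<close>, which lies in a finite product of
  ranks.\<close>

lemma finite_slacks: "finite (slacks j)"
proof -
  let ?c = "\<lambda>(ps, q) z. lk z q - csum j ps z"
  have "?c ` (Collect (selection j) \<times> rk (Suc j)) \<subseteq> ?c ` ((PiE {1..j} rk) \<times> rk (Suc j))"
  proof clarify
    fix ps a b
    assume "selection j ps" "(a, b) \<in> rk (Suc j)"
    then have "(restrict ps {1..j}, a, b) \<in> (PiE {1..j} rk) \<times> rk (Suc j)"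
      by (auto simp: selection_def)
    moreover have "csum j (restrict ps {1..j}) = csum j ps"
      by (rule csum_cong) simp
    ultimately show "(\<lambda>z. lk z (a, b) - csum j ps z) \<in> ?c ` ((PiE {1..j} rk) \<times> rk (Suc j))"
      by (intro image_eqI[where x = "(restrict ps {1..j}, a, b)"]) auto
  qed
  then have "finite (?c ` (Collect (selection j) \<times> rk (Suc j)))"
    by (rule finite_subset) (intro finite_imageI finite_cartesian_product finite_PiE finite_rk; simp)
  then show ?thesis
    by (simp add: slacks_def finite_low finite_steps)
qed

lemma affine_fun_slacks: "g \<in> slacks j \<Longrightarrow> affine_fun g"
proof -
  have "\<forall>g\<in>slacks j. affine_fun g"
    unfolding ball_slacks
    by (auto simp: affine_fun_def csum_def lookup_add lookup_minus lookup_scaleR algebra_simps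
        sum.distrib sum_distrib_left sum_subtractf)
  then show "g \<in> slacks j \<Longrightarrow> affine_fun g"
    by blast
qed

lemma affine_affspace: "affine affspace"
  unfolding affine_alt by (auto simp: affspace_def lookup_add lookup_minus lookup_scaleR algebra_simps)

text \<open>The first two families are also the first two in \<open>ball_slacks_Suc\<close>; the two
  systems differ only in the inequalities that involve rank \<open>k + 1\<close>.\<close>

lemma ball_slacks_split:
  "(\<forall>g\<in>slacks k. Q g) \<longleftrightarrow> (\<forall>p\<in>low k. Q (\<lambda>z. lk z p))
    \<and> (\<forall>(a, b)\<in>steps (Suc k). Q (\<lambda>z. lk z b - lk z a))
    \<and> (\<forall>a\<in>rk (Suc k). \<forall>b\<in>rk (Suc (Suc k)). Q (\<lambda>z. lk z b - lk z a))
    \<and> (\<forall>ps. selection k ps \<longrightarrow> (\<forall>a\<in>rk (Suc k). Q (\<lambda>z. lk z a - csum k ps z)))"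
proof -
  have "steps k = steps (Suc k) \<union> rk (Suc k) \<times> rk (Suc (Suc k))"
    by (auto simp: steps_def rk_def)
  then have "(\<forall>(a, b)\<in>steps k. Q (\<lambda>z. lk z b - lk z a)) \<longleftrightarrow>
    (\<forall>(a, b)\<in>steps (Suc k). Q (\<lambda>z. lk z b - lk z a))
    \<and> (\<forall>a\<in>rk (Suc k). \<forall>b\<in>rk (Suc (Suc k)). Q (\<lambda>z. lk z b - lk z a))"
    by (auto simp: ball_Un)
  then show ?thesis
    unfolding ball_slacks by blast
qed

lemma ball_slacks_Suc:
  "(\<forall>g\<in>slacks (Suc k). Q g) \<longleftrightarrow> (\<forall>p\<in>low k. Q (\<lambda>z. lk z p))
    \<and> (\<forall>(a, b)\<in>steps (Suc k). Q (\<lambda>z. lk z b - lk z a))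
    \<and> (\<forall>a\<in>rk (Suc k). Q (\<lambda>z. lk z a))
    \<and> (\<forall>ps. selection k ps \<longrightarrow>
        (\<forall>a\<in>rk (Suc k). \<forall>b\<in>rk (Suc (Suc k)). Q (\<lambda>z. lk z b - (csum k ps z + lk z a))))"
proof -
  have low: "low (Suc k) = low k \<union> rk (Suc k)"
    by (auto simp: low_def rk_def)
  have "(\<forall>ps. selection (Suc k) ps \<longrightarrow> (\<forall>b\<in>rk (Suc (Suc k)). Q (\<lambda>z. lk z b - csum (Suc k) ps z)))
    \<longleftrightarrow> (\<forall>ps. selection k ps \<longrightarrow>
        (\<forall>a\<in>rk (Suc k). \<forall>b\<in>rk (Suc (Suc k)). Q (\<lambda>z. lk z b - (csum k ps z + lk z a))))"
    (is "?L \<longleftrightarrow> ?R")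
  proof (intro iffI allI impI ballI)
    fix ps a b
    assume L: ?L and *: "selection k ps" "a \<in> rk (Suc k)" "b \<in> rk (Suc (Suc k))"
    \<comment> \<open>A chain up to rank \<open>k\<close> and an element of rank
      \<open>k + 1\<close> combine into a chain up to rank \<open>k + 1\<close>; the update leaves
      the lower ranks alone.\<close>
    have "selection k (ps(Suc k := a)) = selection k ps"
      by (rule selection_cong) auto
    then have "selection (Suc k) (ps(Suc k := a))"
      using * by (auto simp: selection_Suc)
    with L * have "Q (\<lambda>z. lk z b - csum (Suc k) (ps(Suc k := a)) z)"
      by blast
    moreover have "csum k (ps(Suc k := a)) = csum k ps"
      by (rule csum_cong) auto
    ultimately show "Q (\<lambda>z. lk z b - (csum k ps z + lk z a))"
      by (simp add: csum_Suc)
  qed (auto simp: selection_Suc csum_Suc)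
  then show ?thesis
    unfolding ball_slacks[of "Suc k"] low ball_Un by blast
qed

end

section \<open>Passing from level k to level k + 1\<close>

locale rank_step = maximal_ranked +
  fixes k :: nat
  assumes k_less: "k < length tau"
begin

abbreviation P :: "nat \<Rightarrow> (nat \<times> nat \<Rightarrow>\<^sub>0 real) set" where
  "P j \<equiv> polyhedron_in affspace (slacks j)"

abbreviation face :: "nat \<Rightarrow> (nat \<times> nat \<Rightarrow>\<^sub>0 real) \<Rightarrow> (nat \<times> nat \<Rightarrow>\<^sub>0 real) set" where
  "face j \<equiv> tight_face affspace (slacks j)"

abbreviation Y :: "(nat \<times> nat) set" where
  "Y \<equiv> rk (Suc k)"

abbreviation W :: "(nat \<times> nat) set" where
  "W \<equiv> rk (Suc (Suc k))"

abbreviation sel :: "(nat \<Rightarrow> nat \<times> nat) \<Rightarrow> bool" where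
  "sel \<equiv> selection k"

abbreviation cs :: "(nat \<Rightarrow> nat \<times> nat) \<Rightarrow> (nat \<times> nat \<Rightarrow>\<^sub>0 real) \<Rightarrow> real" where
  "cs \<equiv> csum k"

section \<open>Tightness patterns at the two levels\<close>

definition same_tight :: "nat \<Rightarrow> (nat \<times> nat \<Rightarrow>\<^sub>0 real) \<Rightarrow> (nat \<times> nat \<Rightarrow>\<^sub>0 real) \<Rightarrow> bool" where
  "same_tight j x y \<longleftrightarrow> (\<forall>g\<in>slacks j. g x = 0 \<longleftrightarrow> g y = 0)"

text \<open>Together with \<open>z \<in> affspace\<close> this says that \<open>z\<close> lies in
  the affine hull of the face of \<open>x\<close>; \<open>z\<close> itself may violate the
  inequalities.\<close>

definition tight_imp :: "nat \<Rightarrow> (nat \<times> nat \<Rightarrow>\<^sub>0 real) \<Rightarrow> (nat \<times> nat \<Rightarrow>\<^sub>0 real) \<Rightarrow> bool" where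
  "tight_imp j x z \<longleftrightarrow> (\<forall>g\<in>slacks j. g x = 0 \<longrightarrow> g z = 0)"

lemma mem_P:
  "x \<in> P k \<longleftrightarrow> x \<in> affspace \<and> (\<forall>p\<in>low k. 0 \<le> lk x p)
    \<and> (\<forall>(a, b)\<in>steps (Suc k). lk x a \<le> lk x b)
    \<and> (\<forall>a\<in>Y. \<forall>b\<in>W. lk x a \<le> lk x b)
    \<and> (\<forall>ps. sel ps \<longrightarrow> (\<forall>a\<in>Y. cs ps x \<le> lk x a))"
  by (simp add: polyhedron_in_def ball_slacks_split)

lemma mem_P_Suc:
  "x \<in> P (Suc k) \<longleftrightarrow> x \<in> affspace \<and> (\<forall>p\<in>low k. 0 \<le> lk x p)
    \<and> (\<forall>(a, b)\<in>steps (Suc k). lk x a \<le> lk x b)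
    \<and> (\<forall>a\<in>Y. 0 \<le> lk x a)
    \<and> (\<forall>ps. sel ps \<longrightarrow> (\<forall>a\<in>Y. \<forall>b\<in>W. cs ps x + lk x a \<le> lk x b))"
  by (simp add: polyhedron_in_def ball_slacks_Suc)

lemma same_tight_k:
  "same_tight k x y \<longleftrightarrow> (\<forall>p\<in>low k. lk x p = 0 \<longleftrightarrow> lk y p = 0)
    \<and> (\<forall>(a, b)\<in>steps (Suc k). lk x b = lk x a \<longleftrightarrow> lk y b = lk y a)
    \<and> (\<forall>a\<in>Y. \<forall>b\<in>W. lk x b = lk x a \<longleftrightarrow> lk y b = lk y a)
    \<and> (\<forall>ps. sel ps \<longrightarrow> (\<forall>a\<in>Y. lk x a = cs ps x \<longleftrightarrow> lk y a = cs ps y))"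
  by (simp add: same_tight_def ball_slacks_split)

lemma same_tight_Suc:
  "same_tight (Suc k) x y \<longleftrightarrow> (\<forall>p\<in>low k. lk x p = 0 \<longleftrightarrow> lk y p = 0)
    \<and> (\<forall>(a, b)\<in>steps (Suc k). lk x b = lk x a \<longleftrightarrow> lk y b = lk y a)
    \<and> (\<forall>a\<in>Y. lk x a = 0 \<longleftrightarrow> lk y a = 0)
    \<and> (\<forall>ps. sel ps \<longrightarrow>
        (\<forall>a\<in>Y. \<forall>b\<in>W. lk x b = cs ps x + lk x a \<longleftrightarrow> lk y b = cs ps y + lk y a))"
  by (simp add: same_tight_def ball_slacks_Suc)

lemma tight_imp_k:
  "tight_imp k x y \<longleftrightarrow> (\<forall>p\<in>low k. lk x p = 0 \<longrightarrow> lk y p = 0)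
    \<and> (\<forall>(a, b)\<in>steps (Suc k). lk x b = lk x a \<longrightarrow> lk y b = lk y a)
    \<and> (\<forall>a\<in>Y. \<forall>b\<in>W. lk x b = lk x a \<longrightarrow> lk y b = lk y a)
    \<and> (\<forall>ps. sel ps \<longrightarrow> (\<forall>a\<in>Y. lk x a = cs ps x \<longrightarrow> lk y a = cs ps y))"
  by (simp add: tight_imp_def ball_slacks_split)

lemma tight_imp_Suc:
  "tight_imp (Suc k) x y \<longleftrightarrow> (\<forall>p\<in>low k. lk x p = 0 \<longrightarrow> lk y p = 0)
    \<and> (\<forall>(a, b)\<in>steps (Suc k). lk x b = lk x a \<longrightarrow> lk y b = lk y a)
    \<and> (\<forall>a\<in>Y. lk x a = 0 \<longrightarrow> lk y a = 0)
    \<and> (\<forall>ps. sel ps \<longrightarrow>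
        (\<forall>a\<in>Y. \<forall>b\<in>W. lk x b = cs ps x + lk x a \<longrightarrow> lk y b = cs ps y + lk y a))"
  by (simp add: tight_imp_def ball_slacks_Suc)

lemma low_notin_Y: "p \<in> low k \<Longrightarrow> p \<notin> Y"
  and W_notin_Y: "b \<in> W \<Longrightarrow> b \<notin> Y"
  and steps_notin_Y: "(a, b) \<in> steps (Suc k) \<Longrightarrow> a \<notin> Y \<and> b \<notin> Y"
  and sel_in_low: "sel ps \<Longrightarrow> i \<in> {1..k} \<Longrightarrow> ps i \<in> low k"
  and Y_notin_low: "a \<in> Y \<Longrightarrow> a \<notin> low k"
  and W_notin_low: "b \<in> W \<Longrightarrow> b \<notin> low k"
  and steps_notin_low: "(a, b) \<in> steps (Suc k) \<Longrightarrow> a \<notin> low k \<and> b \<notin> low k"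
  by (auto simp: low_def rk_def steps_def selection_def)

lemma sel_in_rk: "sel ps \<Longrightarrow> i \<in> {1..k} \<Longrightarrow> ps i \<in> rk i"
  by (simp add: selection_def)

lemma Y_nonempty: "Y \<noteq> {}" and W_nonempty: "W \<noteq> {}"
  using first_in_rk[of "Suc k"] first_in_rk[of "Suc (Suc k)"] k_less by auto

section \<open>Maximal chains and the elements attaining their sum\<close>

definition maxsel :: "(nat \<times> nat \<Rightarrow>\<^sub>0 real) \<Rightarrow> (nat \<Rightarrow> nat \<times> nat) \<Rightarrow> bool" where
  "maxsel x ps \<longleftrightarrow> sel ps \<and> (\<forall>ps'. sel ps' \<longrightarrow> cs ps' x \<le> cs ps x)"

text \<open>A chain picks its elements independently in each rank, so choosing a largest coordinate
  rank by rank maximizes the sum.\<close>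

lemma maxsel_exists: "\<exists>ps. maxsel x ps"
proof -
  have "\<exists>p\<in>rk i. \<forall>q\<in>rk i. lk x q \<le> lk x p" if "i \<in> {1..k}" for i
  proof -
    have "rk i \<noteq> {}"
      using first_in_rk[of i] that k_less by auto
    then obtain p where "p \<in> rk i" "\<And>q. q \<in> rk i \<Longrightarrow> lk x q \<le> lk x p"
      using finite_argmax[OF finite_rk, of i "lk x"] by metis
    then show ?thesis
      by blast
  qed
  then obtain ps where "\<And>i. i \<in> {1..k} \<Longrightarrow> ps i \<in> rk i \<and> (\<forall>q\<in>rk i. lk x q \<le> lk x (ps i))"
    by metis
  then have "maxsel x ps"
    by (auto simp: maxsel_def csum_def selection_def intro!: sum_mono)
  then show ?thesis
    by blast
qed

lemma cs_nonneg: "\<forall>p\<in>low k. 0 \<le> lk x p \<Longrightarrow> sel ps \<Longrightarrow> 0 \<le> cs ps x"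
  by (auto simp: csum_def intro!: sum_nonneg dest: sel_in_low)

definition on_floor :: "(nat \<times> nat \<Rightarrow>\<^sub>0 real) \<Rightarrow> nat \<times> nat \<Rightarrow> bool" where
  "on_floor x a \<longleftrightarrow> a \<in> Y \<and> (\<exists>ps. sel ps \<and> lk x a = cs ps x)"

lemma P_chain: "x \<in> P k \<Longrightarrow> sel ps \<Longrightarrow> a \<in> Y \<Longrightarrow> cs ps x \<le> lk x a"
  by (simp add: mem_P)

lemma on_floor_iff:
  assumes "x \<in> P k" "maxsel x ps" "a \<in> Y"
  shows "on_floor x a \<longleftrightarrow> lk x a = cs ps x"
proof
  assume "on_floor x a"
  then obtain ps' where "sel ps'" "lk x a = cs ps' x"
    by (auto simp: on_floor_def)
  moreover from this have "cs ps' x \<le> cs ps x" "cs ps x \<le> lk x a"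
    using assms P_chain[OF assms(1) _ assms(3)] by (auto simp: maxsel_def)
  ultimately show "lk x a = cs ps x"
    by simp
qed (use assms in \<open>auto simp: on_floor_def maxsel_def\<close>)

text \<open>In the polytope \<open>lk x a\<close> bounds all chain sums, so equality with one makes
  that one maximal. The tight chain inequalities thus form a product of the maximal selections and
  the elements on the floor.\<close>

lemma chain_tight_iff:
  assumes "x \<in> P k" "sel ps" "a \<in> Y"
  shows "lk x a = cs ps x \<longleftrightarrow> maxsel x ps \<and> on_floor x a"
proof
  assume *: "lk x a = cs ps x"
  with assms have "maxsel x ps"
    using P_chain[OF assms(1) _ assms(3)] by (auto simp: maxsel_def)
  with assms * show "maxsel x ps \<and> on_floor x a"
    by (auto simp: on_floor_def)
next
  assume "maxsel x ps \<and> on_floor x a"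
  with assms show "lk x a = cs ps x"
    using on_floor_iff by blast
qed

section \<open>Attained bounds and canonical maximal chains\<close>

definition bot_tight :: "(nat \<times> nat \<Rightarrow>\<^sub>0 real) \<Rightarrow> bool" where
  "bot_tight x \<longleftrightarrow> (\<exists>a. on_floor x a)"

text \<open>Inside \<open>P k\<close> no coordinate over \<open>Y\<close> exceeds one over
  \<open>W\<close>, so such a \<open>b\<close> minimizes over \<open>W\<close>: the upper bound is
  attained in \<open>Y\<close>.\<close>

definition top_tight :: "(nat \<times> nat \<Rightarrow>\<^sub>0 real) \<Rightarrow> bool" where
  "top_tight x \<longleftrightarrow> (\<exists>a\<in>Y. \<exists>b\<in>W. lk x b = lk x a)"

text \<open>The first nonzero element of its rank, or any element of a rank that vanishes identically.\<close>

definition canonical :: "(nat \<times> nat \<Rightarrow>\<^sub>0 real) \<Rightarrow> nat \<times> nat \<Rightarrow> bool" where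
  "canonical x p \<longleftrightarrow>
    (\<forall>q\<in>Phat tau. fst q = fst p \<and> (lk x p = 0 \<or> snd q < snd p) \<longrightarrow> lk x q = 0)"

text \<open>Such a set of maximal selections can be read off from the zeros in ranks up to
  \<open>k\<close>.\<close>

definition canonical_max :: "(nat \<times> nat \<Rightarrow>\<^sub>0 real) \<Rightarrow> bool" where
  "canonical_max x \<longleftrightarrow> (\<forall>ps. sel ps \<longrightarrow> (maxsel x ps \<longleftrightarrow> (\<forall>i\<in>{1..k}. canonical x (ps i))))"

lemma canonical_cong:
  assumes "\<forall>p\<in>low k. lk x p = 0 \<longleftrightarrow> lk y p = 0" "p \<in> low k"
  shows "canonical x p \<longleftrightarrow> canonical y p"
proof -
  have "lk x q = 0 \<longleftrightarrow> lk y q = 0" if "q \<in> Phat tau" "fst q = fst p" for q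
  proof -
    have "q \<in> low k"
      using assms(2) that by (simp add: low_def)
    with assms(1) show ?thesis
      by blast
  qed
  moreover have "lk x p = 0 \<longleftrightarrow> lk y p = 0"
    using assms by blast
  ultimately show ?thesis
    unfolding canonical_def by metis
qed

lemma canonical_sel_cong:
  assumes "\<forall>p\<in>low k. lk x p = 0 \<longleftrightarrow> lk y p = 0" "sel ps"
  shows "(\<forall>i\<in>{1..k}. canonical x (ps i)) \<longleftrightarrow> (\<forall>i\<in>{1..k}. canonical y (ps i))"
  using canonical_cong[OF assms(1) sel_in_low[OF assms(2)]] by blast

lemma canonicalD:
  assumes "canonical x p" "p \<in> rk i" "q \<in> rk i" "lk x p = 0 \<or> snd q < snd p"
  shows "lk x q = 0"
  using assms by (simp add: canonical_def rk_def)

text \<open>Of two distinct canonical elements, the one with the larger index forces the other to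
  vanish, and a vanishing canonical element forces its whole rank to vanish.\<close>

lemma canonical_unique:
  assumes "p \<in> rk i" "q \<in> rk i" "canonical x p" "canonical x q"
  shows "p = q \<or> lk x p = 0 \<and> lk x q = 0"
proof -
  consider "snd p = snd q" | "snd p < snd q" | "snd q < snd p"
    by linarith
  then show ?thesis
  proof cases
    case 1
    with assms show ?thesis
      by (simp add: rk_def prod_eq_iff)
  next
    case 2
    with assms have "lk x p = 0"
      using canonicalD by blast
    with assms show ?thesis
      using canonicalD by blast
  next
    case 3
    with assms have "lk x q = 0"
      using canonicalD by blast
    with assms show ?thesis
      using canonicalD by blast
  qed
qed

text \<open>A canonical set of maximal chains imposes no equation beyond those from the zero coordinates.\<close>

lemma canonical_max_cs_eq:
  assumes "canonical_max x" "\<forall>p\<in>low k. lk x p = 0 \<longrightarrow> lk z p = 0" "maxsel x ps" "maxsel x ps'"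
  shows "cs ps z = cs ps' z"
  unfolding csum_def
proof (rule sum.cong)
  fix i
  assume i: "i \<in> {1..k}"
  have s: "sel ps" "sel ps'"
    using assms by (auto simp: maxsel_def)
  have "ps i = ps' i \<or> lk x (ps i) = 0 \<and> lk x (ps' i) = 0"
    using assms s i by (intro canonical_unique[of _ i]) (auto simp: canonical_max_def intro: sel_in_rk)
  then show "lk z (ps i) = lk z (ps' i)"
    using assms(2) s i sel_in_low by auto
qed simp

lemma canonical_exists:
  assumes "i \<in> {1..k}"
  obtains p where "p \<in> rk i" "canonical x p"
proof (cases "\<forall>q\<in>rk i. lk x q = 0")
  case True
  have "(i, 1) \<in> rk i"
    using first_in_rk[of i] assms k_less by simp
  with True show thesis
    by (intro that[of "(i, 1)"]) (auto simp: canonical_def rk_def)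
next
  case False
  then obtain p where "p \<in> rk i \<and> lk x p \<noteq> 0"
    "\<And>q. q \<in> rk i \<and> lk x q \<noteq> 0 \<Longrightarrow> snd p \<le> snd q"
    using ex_has_least_nat[of "\<lambda>q. q \<in> rk i \<and> lk x q \<noteq> 0" _ snd] by blast
  then show thesis
    by (intro that[of p]) (force simp: canonical_def rk_def)+
qed

section \<open>The two linear maps and their effect on dimension\<close>

lemma overwrite_Y:
  "a \<in> Y \<Longrightarrow> lk (overwrite Y f z) a = f a"
  "p \<in> low k \<Longrightarrow> lk (overwrite Y f z) p = lk z p"
  "b \<in> W \<Longrightarrow> lk (overwrite Y f z) b = lk z b"
  "(a, b) \<in> steps (Suc k) \<Longrightarrow> lk (overwrite Y f z) a = lk z a"
  "(a, b) \<in> steps (Suc k) \<Longrightarrow> lk (overwrite Y f z) b = lk z b"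
  "sel ps \<Longrightarrow> cs ps (overwrite Y f z) = cs ps z"
  using low_notin_Y W_notin_Y steps_notin_Y low_notin_Y[OF sel_in_low]
  by (auto simp: lookup_overwrite finite_rk csum_def intro!: sum.cong)

lemma overwrite_Y_affspace: "overwrite Y f z \<in> affspace \<longleftrightarrow> z \<in> affspace"
proof -
  have "zero_hat tau \<notin> Y" "one_hat tau \<notin> Y" "\<And>p. p \<notin> Phat tau \<Longrightarrow> p \<notin> Y"
    using k_less by (auto simp: rk_def zero_hat_def one_hat_def)
  then show ?thesis
    by (simp add: affspace_def lookup_overwrite finite_rk)
qed

text \<open>If the equations of the two faces correspond at all points \<open>z\<close>, then
  \<open>h\<close> carries one affine hull onto the other, and a linear bijection preserves
  dimension.\<close>

lemma affdim_tight_face_eq: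
  assumes h: "linear h" "bij h" and V: "\<And>z. h z \<in> affspace \<longleftrightarrow> z \<in> affspace"
    and x: "x \<in> P k" "h x \<in> P (Suc k)"
    and tight: "\<And>z. tight_imp k x z \<longleftrightarrow> tight_imp (Suc k) (h x) (h z)"
  shows "affdim (face (Suc k) (h x)) = affdim (face k x)"
proof -
  have "h ` tight_hull affspace (slacks k) x = tight_hull affspace (slacks (Suc k)) (h x)"
  proof (intro set_eqI iffI)
    fix y
    assume y: "y \<in> tight_hull affspace (slacks (Suc k)) (h x)"
    obtain z where "y = h z"
      using h(2) by (meson bij_pointE)
    with y have "z \<in> tight_hull affspace (slacks k) x"
      using tight V by (auto simp: tight_hull_def tight_imp_def)
    with \<open>y = h z\<close> show "y \<in> h ` tight_hull affspace (slacks k) x"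
      by blast
  qed (use tight V in \<open>auto simp: tight_hull_def tight_imp_def\<close>)
  then have "affine hull (face (Suc k) (h x))
    = h ` (affine hull (face k x))"
    using x by (simp add: affine_hull_tight_face affine_affspace finite_slacks affine_fun_slacks)
  then have "affdim (affine hull (face (Suc k) (h x)))
    = affdim (affine hull (face k x))"
    by (simp add: affdim_image_linear[OF h])
  then show ?thesis
    by (simp only: affdim_affine_hull)
qed

text \<open>The selection stays fixed while \<open>z\<close> varies, which makes the map linear on
  the whole space. It subtracts the largest chain sum only where \<open>ps\<close> is
  maximal.\<close>

definition transfer :: "(nat \<Rightarrow> nat \<times> nat) \<Rightarrow> (nat \<times> nat \<Rightarrow>\<^sub>0 real) \<Rightarrow> (nat \<times> nat \<Rightarrow>\<^sub>0 real)" where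
  "transfer ps z = overwrite Y (\<lambda>q. lk z q - cs ps z) z"

text \<open>Likewise \<open>b\<close> is fixed in place of the minimum over \<open>W\<close>, to
  keep the map linear.\<close>

definition dual :: "nat \<times> nat \<Rightarrow> (nat \<times> nat \<Rightarrow>\<^sub>0 real) \<Rightarrow> (nat \<times> nat \<Rightarrow>\<^sub>0 real)" where
  "dual b z = overwrite Y (\<lambda>q. lk z b - lk z q) z"

lemma linear_cs: "linear (cs ps)"
  by (intro linearI) (auto simp: csum_def lookup_add lookup_scaleR sum.distrib sum_distrib_left)

lemma linear_transfer: "linear (transfer ps)"
  unfolding transfer_def
  by (intro linear_overwrite finite_rk linear_compose_sub linear_lookup linear_cs)

lemma linear_dual: "linear (dual b)"
  unfolding dual_def
  by (intro linear_overwrite finite_rk linear_compose_sub linear_lookup)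

lemma bij_transfer:
  assumes "sel ps"
  shows "bij (transfer ps)"
proof (rule o_bij)
  let ?u = "\<lambda>z. overwrite Y (\<lambda>q. lk z q + cs ps z) z"
  show "?u \<circ> transfer ps = id" "transfer ps \<circ> ?u = id"
    using assms by (auto simp: fun_eq_iff transfer_def overwrite_Y(6)
        lookup_overwrite finite_rk intro!: poly_mapping_eqI)
qed

lemma bij_dual:
  assumes "b \<in> W"
  shows "bij (dual b)"
proof (rule o_bij)
  show "dual b \<circ> dual b = id" "dual b \<circ> dual b = id"
    using W_notin_Y[OF assms]
    by (auto simp: fun_eq_iff dual_def lookup_overwrite finite_rk intro!: poly_mapping_eqI)
qed

lemma transfer_mem:
  assumes "x \<in> P k" "maxsel x ps"
  shows "transfer ps x \<in> P (Suc k)"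
proof -
  have "cs ps' x + (lk x a - cs ps x) \<le> lk x b" if "sel ps'" "a \<in> Y" "b \<in> W" for ps' a b
  proof -
    have "cs ps' x \<le> cs ps x" "lk x a \<le> lk x b"
      using assms that by (auto simp: mem_P maxsel_def)
    then show ?thesis
      by linarith
  qed
  with assms show ?thesis
    by (auto simp: mem_P mem_P_Suc transfer_def overwrite_Y overwrite_Y_affspace maxsel_def)
qed

text \<open>The slack of the new chain inequality is the sum of the nonnegative slacks
  \<open>cs ps x - cs ps' x\<close> and \<open>lk x b - lk x a\<close>, so it vanishes iff both
  do.\<close>

lemma transfer_chain_iff:
  assumes "x \<in> P k" "maxsel x ps" "sel ps'" "a \<in> Y" "b \<in> W"
  shows "lk x b = cs ps' x + (lk x a - cs ps x) \<longleftrightarrow> maxsel x ps' \<and> lk x b = lk x a"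
proof -
  have 1: "cs ps' x \<le> cs ps x" "lk x a \<le> lk x b"
    using assms by (auto simp: mem_P maxsel_def)
  have 2: "maxsel x ps' \<longleftrightarrow> cs ps' x = cs ps x"
    using assms by (auto simp: maxsel_def intro: order_antisym)
  show ?thesis
    unfolding 2 using 1 by linarith
qed

text \<open>The two equation systems can differ only in whether all maximal chain sums are forced to
  agree: an element on the floor forces this at level \<open>k\<close>, a tight pair between
  \<open>Y\<close> and \<open>W\<close> at level \<open>k + 1\<close>. Hypothesis \<open>c\<close>
  ensures that both occur or neither does, or that the zeros already force the agreement.\<close>

lemma affdim_transfer:
  assumes x: "x \<in> P k" and ps: "maxsel x ps"
    and c: "canonical_max x \<or> (bot_tight x \<longleftrightarrow> top_tight x)"
  shows "affdim (face (Suc k) (transfer ps x))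
    = affdim (face k x)"
proof (rule affdim_tight_face_eq)
  have s: "sel ps"
    using ps by (simp add: maxsel_def)
  show "linear (transfer ps)" "bij (transfer ps)" "transfer ps x \<in> P (Suc k)" "x \<in> P k"
    using linear_transfer bij_transfer[OF s] transfer_mem x ps by auto
  show "transfer ps z \<in> affspace \<longleftrightarrow> z \<in> affspace" for z
    by (simp add: transfer_def overwrite_Y_affspace)
  fix z
  have L: "tight_imp k x z \<longleftrightarrow> (\<forall>p\<in>low k. lk x p = 0 \<longrightarrow> lk z p = 0)
    \<and> (\<forall>(a, b)\<in>steps (Suc k). lk x b = lk x a \<longrightarrow> lk z b = lk z a)
    \<and> (\<forall>a\<in>Y. \<forall>b\<in>W. lk x b = lk x a \<longrightarrow> lk z b = lk z a)
    \<and> (\<forall>ps'. sel ps' \<longrightarrow> (\<forall>a\<in>Y. maxsel x ps' \<and> on_floor x a \<longrightarrow> lk z a = cs ps' z))"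
    using x by (simp add: tight_imp_k chain_tight_iff)
  have R: "tight_imp (Suc k) (transfer ps x) (transfer ps z) \<longleftrightarrow>
    (\<forall>p\<in>low k. lk x p = 0 \<longrightarrow> lk z p = 0)
    \<and> (\<forall>(a, b)\<in>steps (Suc k). lk x b = lk x a \<longrightarrow> lk z b = lk z a)
    \<and> (\<forall>a\<in>Y. on_floor x a \<longrightarrow> lk z a = cs ps z)
    \<and> (\<forall>ps'. sel ps' \<longrightarrow> (\<forall>a\<in>Y. \<forall>b\<in>W. maxsel x ps' \<and> lk x b = lk x a
        \<longrightarrow> lk z b = cs ps' z + (lk z a - cs ps z)))"
    using on_floor_iff[OF x ps] transfer_chain_iff[OF x ps]
    by (auto simp: tight_imp_Suc transfer_def overwrite_Y)
  show "tight_imp k x z \<longleftrightarrow> tight_imp (Suc k) (transfer ps x) (transfer ps z)"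
  proof
    assume l: "tight_imp k x z"
    have "cs ps' z = cs ps z" if "maxsel x ps'" "top_tight x" for ps'
    proof (cases "canonical_max x")
      case True
      then show ?thesis
        using that l ps L canonical_max_cs_eq by blast
    next
      case False
      with c that obtain a where "on_floor x a"
        by (auto simp: bot_tight_def)
      moreover from this have "a \<in> Y"
        by (simp add: on_floor_def)
      moreover have "sel ps'"
        using that by (simp add: maxsel_def)
      ultimately have "lk z a = cs ps' z" "lk z a = cs ps z"
        using that l ps s unfolding L by blast+
      then show ?thesis
        by simp
    qed
    then have "lk z b = cs ps' z + (lk z a - cs ps z)"
      if "maxsel x ps'" "lk x b = lk x a" "a \<in> Y" "b \<in> W" for ps' a b
      using that l unfolding L by (auto simp: top_tight_def)
    with l s ps show "tight_imp (Suc k) (transfer ps x) (transfer ps z)"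
      unfolding L R by blast
  next
    assume r: "tight_imp (Suc k) (transfer ps x) (transfer ps z)"
    \<comment> \<open>With the reference selection \<open>ps\<close> in the chain equation the chain
      sums cancel.\<close>
    have ab: "lk z b = lk z a" if "lk x b = lk x a" "a \<in> Y" "b \<in> W" for a b
    proof -
      have "lk z b = cs ps z + (lk z a - cs ps z)"
        using r that s ps unfolding R by blast
      then show ?thesis
        by simp
    qed
    have "cs ps' z = cs ps z" if m: "maxsel x ps'" "bot_tight x" for ps'
    proof (cases "canonical_max x")
      case True
      then show ?thesis
        using that r ps R canonical_max_cs_eq by blast
    next
      case False
      with c that obtain a b where *: "a \<in> Y" "b \<in> W" "lk x b = lk x a"
        by (auto simp: top_tight_def)
      moreover have "sel ps'"
        using m by (simp add: maxsel_def)
      ultimately have "lk z b = cs ps' z + (lk z a - cs ps z)"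
        using r m unfolding R by blast
      with ab * show ?thesis
        by simp
    qed
    moreover have "bot_tight x" if "on_floor x a" for a
      using that by (unfold bot_tight_def) (rule exI)
    ultimately have "lk z a = cs ps' z" if "maxsel x ps'" "on_floor x a" "a \<in> Y" for ps' a
      using that r unfolding R by metis
    with r ab show "tight_imp k x z"
      unfolding L R by blast
  qed
qed

text \<open>The last clause says that equality with any other minimizer in rank \<open>k + 2\<close> is already forced by
tight order inequalities above.\<close>

definition lowest :: "(nat \<times> nat \<Rightarrow>\<^sub>0 real) \<Rightarrow> nat \<times> nat \<Rightarrow> bool" where
  "lowest x b \<longleftrightarrow> b \<in> W \<and> (\<forall>b'\<in>W. lk x b \<le> lk x b')
    \<and> (\<forall>b'\<in>W. lk x b' = lk x b \<longrightarrow> b' = b \<or>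
        (\<exists>c. (b, c) \<in> steps (Suc k) \<and> (b', c) \<in> steps (Suc k) \<and> lk x c = lk x b))"

lemma dual_mem:
  assumes x: "x \<in> P k" and b: "lowest x b"
  shows "dual b x \<in> P (Suc k)"
proof -
  have "cs ps x + (lk x b - lk x a) \<le> lk x b'" if "sel ps" "a \<in> Y" "b' \<in> W" for ps a b'
  proof -
    have "cs ps x \<le> lk x a" "lk x b \<le> lk x b'"
      using x b that by (auto simp: mem_P lowest_def)
    then show ?thesis
      by linarith
  qed
  moreover have "b \<in> W"
    using b by (simp add: lowest_def)
  ultimately show ?thesis
    using x by (auto simp: mem_P mem_P_Suc dual_def overwrite_Y overwrite_Y_affspace)
qed

text \<open>The slack is again a sum of two nonnegative ones, \<open>lk x a - cs ps x\<close> and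
  \<open>lk x b' - lk x b\<close>.\<close>

lemma dual_chain_iff:
  assumes x: "x \<in> P k" and b: "lowest x b" and "sel ps" "a \<in> Y" "b' \<in> W"
  shows "lk x b' = cs ps x + (lk x b - lk x a) \<longleftrightarrow> (maxsel x ps \<and> on_floor x a) \<and> lk x b' = lk x b"
proof -
  have "cs ps x \<le> lk x a" "lk x b \<le> lk x b'"
    using assms by (auto simp: mem_P lowest_def)
  moreover have "maxsel x ps \<and> on_floor x a \<longleftrightarrow> lk x a = cs ps x"
    using assms by (simp add: chain_tight_iff)
  ultimately show ?thesis
    by auto
qed

text \<open>As the upper bound is not attained in \<open>Y\<close>, the image has no zero there. The
  only other candidates for new equations equate minimizers over \<open>W\<close>, and
  \<open>lowest\<close> derives these from tight steps above.\<close>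

lemma affdim_dual:
  assumes x: "x \<in> P k" and b: "lowest x b" and nt: "\<not> top_tight x"
  shows "affdim (face (Suc k) (dual b x))
    = affdim (face k x)"
proof (rule affdim_tight_face_eq)
  have bW: "b \<in> W"
    using b by (simp add: lowest_def)
  show "linear (dual b)" "bij (dual b)" "dual b x \<in> P (Suc k)" "x \<in> P k"
    using linear_dual bij_dual[OF bW] dual_mem x b by auto
  show "dual b z \<in> affspace \<longleftrightarrow> z \<in> affspace" for z
    by (simp add: dual_def overwrite_Y_affspace)
  fix z
  have ne: "lk x b' \<noteq> lk x a" if "a \<in> Y" "b' \<in> W" for a b'
    using nt that by (auto simp: top_tight_def)
  have L: "tight_imp k x z \<longleftrightarrow> (\<forall>p\<in>low k. lk x p = 0 \<longrightarrow> lk z p = 0)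
    \<and> (\<forall>(a, b)\<in>steps (Suc k). lk x b = lk x a \<longrightarrow> lk z b = lk z a)
    \<and> (\<forall>ps'. sel ps' \<longrightarrow> (\<forall>a\<in>Y. maxsel x ps' \<and> on_floor x a \<longrightarrow> lk z a = cs ps' z))"
    using x ne by (simp add: tight_imp_k chain_tight_iff)
  have R: "tight_imp (Suc k) (dual b x) (dual b z) \<longleftrightarrow>
    (\<forall>p\<in>low k. lk x p = 0 \<longrightarrow> lk z p = 0)
    \<and> (\<forall>(a, b)\<in>steps (Suc k). lk x b = lk x a \<longrightarrow> lk z b = lk z a)
    \<and> (\<forall>ps'. sel ps' \<longrightarrow> (\<forall>a\<in>Y. \<forall>b'\<in>W. (maxsel x ps' \<and> on_floor x a) \<and> lk x b' = lk x b
        \<longrightarrow> lk z b' = cs ps' z + (lk z b - lk z a)))"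
    using dual_chain_iff[OF x b] ne bW
    by (auto simp: tight_imp_Suc dual_def overwrite_Y)
  show "tight_imp k x z \<longleftrightarrow> tight_imp (Suc k) (dual b x) (dual b z)"
  proof
    assume l: "tight_imp k x z"
    have "lk z b' = lk z b" if b': "b' \<in> W" "lk x b' = lk x b" for b'
    proof (cases "b' = b")
      case False
      with b b' obtain c where c: "(b, c) \<in> steps (Suc k)" "(b', c) \<in> steps (Suc k)" "lk x c = lk x b"
        by (auto simp: lowest_def)
      with l b' have "lk z c = lk z b" "lk z c = lk z b'"
        unfolding L by fastforce+
      then show ?thesis
        by simp
    qed simp
    with l show "tight_imp (Suc k) (dual b x) (dual b z)"
      unfolding L R by auto
  next
    assume r: "tight_imp (Suc k) (dual b x) (dual b z)"
    have "lk z a = cs ps' z" if "sel ps'" "a \<in> Y" "maxsel x ps' \<and> on_floor x a" for ps' a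
    proof -
      have "lk z b = cs ps' z + (lk z b - lk z a)"
        using r that bW unfolding R by blast
      then show ?thesis
        by simp
    qed
    with r show "tight_imp k x z"
      unfolding L R by blast
  qed
qed

section \<open>Moving a point inside its face to normal form\<close>

text \<open>Each clause treats something invisible at level \<open>k\<close> that the image may
  reveal: the set of maximal chains when the floor is empty, the set of minimizers over
  \<open>W\<close> when the upper bound is not attained.\<close>

definition normal :: "(nat \<times> nat \<Rightarrow>\<^sub>0 real) \<Rightarrow> bool" where
  "normal x \<longleftrightarrow> (\<not> bot_tight x \<longrightarrow> canonical_max x)
    \<and> (bot_tight x \<and> \<not> top_tight x \<longrightarrow> (\<exists>b. lowest x b))"

lemma bot_tight_cong:
  assumes "same_tight k x y"
  shows "bot_tight x \<longleftrightarrow> bot_tight y"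
  using assms by (fastforce simp: same_tight_k bot_tight_def on_floor_def)

text \<open>Since no chain inequality is tight, the nonzero coordinates in ranks up to
  \<open>k\<close> can be replaced by small positive values: a larger one at canonical elements, a
  smaller one elsewhere.\<close>

lemma normalize_not_bot_tight:
  assumes x: "x \<in> P k" and nb: "\<not> bot_tight x"
  obtains y where "y \<in> P k" "same_tight k x y" "canonical_max y"
proof -
  obtain q0 where q0: "q0 \<in> Y" "\<And>q. q \<in> Y \<Longrightarrow> lk x q0 \<le> lk x q"
    using finite_argmin[OF finite_rk Y_nonempty, of "lk x"] by blast
  have nt: "lk x a \<noteq> cs ps x" if "sel ps" "a \<in> Y" for ps a
    using nb that unfolding bot_tight_def on_floor_def by blast
  obtain ps0 where "sel ps0"
    using maxsel_exists[of x] by (auto simp: maxsel_def)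
  then have "0 \<le> cs ps0 x" "cs ps0 x \<le> lk x q0" "lk x q0 \<noteq> cs ps0 x"
    using x q0 cs_nonneg P_chain nt by (auto simp: mem_P)
  then have q0_pos: "0 < lk x q0"
    by linarith
  \<comment> \<open>Any \<open>k\<close> coordinates of size at most \<open>d\<close> sum to less
    than the minimum over \<open>Y\<close>. The denominator \<open>k + 1\<close> gives strictness
    and covers \<open>k = 0\<close>.\<close>
  define d where "d = lk x q0 / (k + 1)"
  have d: "0 < d" "k * d < lk x q0"
    using q0_pos by (auto simp: d_def field_simps)
  define y where "y = overwrite (low k)
    (\<lambda>p. if lk x p = 0 then 0 else if canonical x p then d else d / 2) x"
  have y_low: "lk y p = (if lk x p = 0 then 0 else if canonical x p then d else d / 2)"
    if "p \<in> low k" for p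
    using that by (simp add: y_def lookup_overwrite finite_low)
  have y_else: "lk y p = lk x p" if "p \<notin> low k" for p
    using that by (simp add: y_def lookup_overwrite finite_low)
  have y_le: "cs ps y < lk y a" if "sel ps" "a \<in> Y" for ps a
  proof -
    have "cs ps y \<le> real (card {1..k}) * d"
      unfolding csum_def using d sel_in_low[OF that(1)] by (intro sum_bounded_above) (simp add: y_low)
    also have "\<dots> < lk x q0"
      using d by simp
    also have "\<dots> \<le> lk y a"
      using q0 that y_else Y_notin_low by auto
    finally show ?thesis .
  qed
  have nonneg: "0 \<le> lk y p" if "p \<in> low k" for p
    using d that by (simp add: y_low)
  have zeros: "\<forall>p\<in>low k. lk x p = 0 \<longleftrightarrow> lk y p = 0"
    using d by (simp add: y_low)
  have "y \<in> affspace"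
  proof -
    have "zero_hat tau \<in> low k" "one_hat tau \<notin> low k" "\<And>p. p \<notin> Phat tau \<Longrightarrow> p \<notin> low k"
      using k_less first_in_rk[of 0] by (auto simp: low_def one_hat_def zero_hat_def rk_def)
    moreover have "x \<in> affspace"
      using x by (simp add: mem_P)
    ultimately show ?thesis
      by (simp add: affspace_def y_low y_else)
  qed
  then have yP: "y \<in> P k"
    using x nonneg y_le y_else Y_notin_low W_notin_low steps_notin_low
    by (fastforce simp: mem_P intro: less_imp_le)
  have same: "same_tight k x y"
    unfolding same_tight_k
    using zeros nt y_le y_else Y_notin_low W_notin_low steps_notin_low by fastforce
  have dom: "lk y q \<le> lk y p" if "p \<in> rk i" "q \<in> rk i" "i \<in> {1..k}" "canonical x p" for p q i
  proof -
    have "p \<in> low k" "q \<in> low k"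
      using that by (auto simp: rk_def low_def)
    then show ?thesis
      using that d canonicalD[of x p i q] by (auto simp: y_low)
  qed
  have strict: "lk y q < lk y p"
    if "p \<in> rk i" "q \<in> rk i" "i \<in> {1..k}" "canonical x p" "\<not> canonical x q" for p q i
  proof -
    have "p \<in> low k" "q \<in> low k"
      using that by (auto simp: rk_def low_def)
    \<comment> \<open>A vanishing canonical element would make its whole rank vanish and hence
      \<open>q\<close> canonical too.\<close>
    moreover have "lk x p \<noteq> 0"
    proof
      assume "lk x p = 0"
      then have "\<forall>r\<in>rk i. lk x r = 0"
        using canonicalD[OF that(4,1)] by blast
      then have "canonical x q"
        using that(2) by (auto simp: canonical_def rk_def)
      with that show False
        by blast
    qed
    ultimately show ?thesis
      using that d by (auto simp: y_low)
  qed
  have "maxsel y ps \<longleftrightarrow> (\<forall>i\<in>{1..k}. canonical x (ps i))" if s: "sel ps" for ps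
  proof
    assume m: "maxsel y ps"
    show "\<forall>i\<in>{1..k}. canonical x (ps i)"
    proof (rule ccontr)
      assume "\<not> (\<forall>i\<in>{1..k}. canonical x (ps i))"
      then obtain i where i: "i \<in> {1..k}" "\<not> canonical x (ps i)"
        by blast
      \<comment> \<open>Exchanging the element of rank \<open>i\<close> for a canonical one strictly
        increases the chain sum.\<close>
      obtain c where c: "c \<in> rk i" "canonical x c"
        using canonical_exists[OF i(1)] by blast
      have "sel (ps(i := c))"
        using s c by (simp add: selection_def)
      moreover have "cs ps y < cs (ps(i := c)) y"
        unfolding csum_def
        using i strict[OF c(1) sel_in_rk[OF s i(1)] i(1) c(2) i(2)]
        by (intro sum_strict_mono_ex1) (auto intro!: bexI[of _ i])
      ultimately show False
        using m by (auto simp: maxsel_def not_less[symmetric])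
    qed
  next
    assume "\<forall>i\<in>{1..k}. canonical x (ps i)"
    then have "cs ps' y \<le> cs ps y" if "sel ps'" for ps'
      unfolding csum_def
      using dom[OF sel_in_rk[OF s] sel_in_rk[OF that]] by (intro sum_mono) blast
    with s show "maxsel y ps"
      by (simp add: maxsel_def)
  qed
  then have "canonical_max y"
    using canonical_sel_cong[OF zeros] by (simp add: canonical_max_def)
  with that yP same show thesis
    by blast
qed

text \<open>If no tight step ascends from a minimizer \<open>b\<close>, its coordinate alone can be
  lowered to make it the unique minimizer, provided it is not the fixed top element.\<close>

lemma normalize_not_top_tight:
  assumes x: "x \<in> P k" and nt: "\<not> top_tight x"
  obtains y b where "y \<in> P k" "same_tight k x y" "lowest y b"
proof -
  obtain b where b: "b \<in> W" "\<And>b'. b' \<in> W \<Longrightarrow> lk x b \<le> lk x b'"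
    using finite_argmin[OF finite_rk W_nonempty, of "lk x"] by blast
  show thesis
  proof (cases "\<exists>c. (b, c) \<in> steps (Suc k) \<and> lk x c = lk x b")
    case True
    then obtain c where c: "(b, c) \<in> steps (Suc k)" "lk x c = lk x b"
      by blast
    \<comment> \<open>Every element of \<open>W\<close> lies below this \<open>c\<close>, so it
      witnesses \<open>lowest\<close> for all minimizers at once.\<close>
    then have "(b', c) \<in> steps (Suc k)" if "b' \<in> W" for b'
      using that b by (auto simp: steps_def rk_def)
    with b c have "lowest x b"
      unfolding lowest_def by metis
    with x show thesis
      by (intro that[of x b]) (auto simp: same_tight_def)
  next
    case False
    show thesis
    \<comment> \<open>In this case \<open>W\<close> consists of the maximum only, whose coordinate
      is fixed to 1.\<close>
    proof (cases "Suc k = length tau")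
      case True
      then have "lowest x b"
        using b one_hat_iff by (auto simp: lowest_def)
      with x show thesis
        by (intro that[of x b]) (auto simp: same_tight_def)
    next
      case not_last: False
      obtain a0 where a0: "a0 \<in> Y" "\<And>a. a \<in> Y \<Longrightarrow> lk x a \<le> lk x a0"
        using finite_argmax[OF finite_rk Y_nonempty, of "lk x"] by blast
      have less: "lk x a < lk x b'" if "a \<in> Y" "b' \<in> W" for a b'
        using x nt that by (force simp: mem_P top_tight_def less_le)
      \<comment> \<open>The new value lies strictly between the maximum over \<open>Y\<close> and
        the minimum over \<open>W\<close>, so no order relation with \<open>Y\<close> becomes
        tight.\<close>
      define m where "m = (lk x a0 + lk x b) / 2"
      have m: "lk x a0 < m" "m < lk x b"
        using less[OF a0(1) b(1)] by (auto simp: m_def)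
      define y where "y = overwrite {b} (\<lambda>_. m) x"
      have y_b: "lk y b = m" and y_else: "p \<noteq> b \<Longrightarrow> lk y p = lk x p" for p
        by (simp_all add: y_def lookup_overwrite)
      have y_low: "lk y p = lk x p" if "p \<in> low k" for p
        using that W_notin_low[OF b(1)] y_else by metis
      have y_Y: "lk y a = lk x a" if "a \<in> Y" for a
        using that W_notin_Y[OF b(1)] y_else by metis
      have y_cs: "cs ps y = cs ps x" if "sel ps" for ps
        unfolding csum_def using that sel_in_low y_low by (intro sum.cong) auto
      have y_less: "lk y a < lk y b'" if "a \<in> Y" "b' \<in> W" for a b'
        using a0(2)[OF that(1)] m less[OF that] y_b y_else[of b'] y_Y[OF that(1)]
        by (cases "b' = b") auto
      have up: "b \<noteq> c" if "(a, c) \<in> steps (Suc k)" for a c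
        using that b(1) by (auto simp: steps_def rk_def)
      have steps_less: "lk x b < lk x c" if "(b, c) \<in> steps (Suc k)" for c
      proof -
        have "lk x b \<le> lk x c"
          using that x by (auto simp: mem_P)
        moreover have "lk x c \<noteq> lk x b"
          using that False by blast
        ultimately show ?thesis
          by simp
      qed
      have y_steps: "lk y a \<le> lk y c \<and> (lk x c = lk x a \<longleftrightarrow> lk y c = lk y a)"
        if "(a, c) \<in> steps (Suc k)" for a c
      proof (cases "a = b")
        case True
        with that steps_less[of c] up[OF that] y_else[of c] y_b m show ?thesis
          by auto
      next
        case False
        with that up[OF that] y_else[of c] y_else[of a] x show ?thesis
          by (auto simp: mem_P)
      qed
      have "y \<in> affspace"
      proof -
        have "b \<noteq> zero_hat tau" "b \<noteq> one_hat tau" "b \<in> Phat tau"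
          using b(1) not_last by (auto simp: rk_def zero_hat_def one_hat_def)
        moreover have "x \<in> affspace"
          using x by (simp add: mem_P)
        ultimately show ?thesis
          unfolding affspace_def using y_else by auto metis
      qed
      then have "y \<in> P k"
        using x y_low y_Y y_cs y_less y_steps by (auto simp: mem_P less_imp_le)
      moreover have "same_tight k x y"
        unfolding same_tight_k
        using y_low y_Y y_cs y_less less y_steps by fastforce
      moreover have "lowest y b"
      proof -
        have "lk y b < lk y b'" if "b' \<in> W" "b' \<noteq> b" for b'
          using b(2)[OF that(1)] m y_b y_else[OF that(2)] by simp
        then show ?thesis
          using b(1) by (force simp: lowest_def)
      qed
      ultimately show thesis
        by (rule that)
    qed
  qed
qed

lemma normalize:
  assumes x: "x \<in> P k"
  obtains y where "y \<in> P k" "same_tight k x y" "normal y"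
proof (cases "bot_tight x")
  case False
  then obtain y where y: "y \<in> P k" "same_tight k x y" "canonical_max y"
    using normalize_not_bot_tight[OF x] by blast
  moreover have "\<not> bot_tight y"
    using bot_tight_cong y False by blast
  ultimately show thesis
    using that by (simp add: normal_def)
next
  case True
  show thesis
  proof (cases "top_tight x")
    case True
    with \<open>bot_tight x\<close> x that[of x] show thesis
      by (simp add: normal_def same_tight_def)
  next
    case False
    then obtain y b where y: "y \<in> P k" "same_tight k x y" "lowest y b"
      using normalize_not_top_tight[OF x] by blast
    moreover have "bot_tight y"
      using bot_tight_cong y True by blast
    ultimately show thesis
      using that[of y] unfolding normal_def by blast
  qed
qed

section \<open>The combined map on points and recovery of the pattern\<close>

text \<open>Here \<open>transfer\<close> would lose information: the floor shows a noncanonical set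
  of maximal chains at level \<open>k\<close>, but no tight pair would show it at level
  \<open>k + 1\<close>.\<close>

definition dualized :: "(nat \<times> nat \<Rightarrow>\<^sub>0 real) \<Rightarrow> bool" where
  "dualized x \<longleftrightarrow> bot_tight x \<and> \<not> top_tight x \<and> \<not> canonical_max x"

definition push :: "(nat \<times> nat \<Rightarrow>\<^sub>0 real) \<Rightarrow> (nat \<times> nat \<Rightarrow>\<^sub>0 real)" where
  "push x = (if dualized x then dual (SOME b. lowest x b) x else transfer (SOME ps. maxsel x ps) x)"

lemma push_transfer:
  assumes "\<not> dualized x"
  obtains ps where "maxsel x ps" "push x = transfer ps x"
  using assms someI_ex[OF maxsel_exists[of x]] that by (simp add: push_def)

lemma push_dual:
  assumes "dualized x" "normal x"
  obtains b where "lowest x b" "push x = dual b x"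
proof -
  have "\<exists>b. lowest x b"
    using assms by (simp add: normal_def dualized_def)
  then show thesis
    using assms(1) someI_ex[of "lowest x"] that by (simp add: push_def)
qed

lemma push_mem: "x \<in> P k \<Longrightarrow> normal x \<Longrightarrow> push x \<in> P (Suc k)"
  by (metis push_transfer push_dual transfer_mem dual_mem)

lemma affdim_push:
  assumes "x \<in> P k" "normal x"
  shows "affdim (face (Suc k) (push x))
    = affdim (face k x)"
proof (cases "dualized x")
  case True
  then obtain b where "lowest x b" "push x = dual b x"
    using assms push_dual by blast
  with assms True show ?thesis
    using affdim_dual by (auto simp: dualized_def)
next
  case False
  then obtain ps where "maxsel x ps" "push x = transfer ps x"
    using push_transfer by blast
  moreover have "canonical_max x \<or> (bot_tight x \<longleftrightarrow> top_tight x)"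
    using False assms by (auto simp: dualized_def normal_def)
  ultimately show ?thesis
    using assms affdim_transfer by auto
qed

lemma canonical_max_eq:
  assumes "canonical_max x" "canonical_max y" "\<forall>p\<in>low k. lk x p = 0 \<longleftrightarrow> lk y p = 0"
  shows "maxsel x ps \<longleftrightarrow> maxsel y ps"
proof (cases "sel ps")
  case True
  then show ?thesis
    using assms canonical_sel_cong[OF assms(3)] by (auto simp: canonical_max_def)
qed (simp add: maxsel_def)

lemma canonical_max_transport:
  assumes "canonical_max x" "\<And>ps. maxsel x ps \<longleftrightarrow> maxsel y ps"
    "\<forall>p\<in>low k. lk x p = 0 \<longleftrightarrow> lk y p = 0"
  shows "canonical_max y"
  using assms canonical_sel_cong[OF assms(3)] by (simp add: canonical_max_def)

lemma same_tight_kI: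
  assumes "x \<in> P k" "y \<in> P k"
    and "\<forall>p\<in>low k. lk x p = 0 \<longleftrightarrow> lk y p = 0"
    and "\<forall>(a, b)\<in>steps (Suc k). lk x b = lk x a \<longleftrightarrow> lk y b = lk y a"
    and "\<And>a b. a \<in> Y \<Longrightarrow> b \<in> W \<Longrightarrow> lk x b = lk x a \<longleftrightarrow> lk y b = lk y a"
    and "\<And>ps a. sel ps \<Longrightarrow> a \<in> Y \<Longrightarrow> maxsel x ps \<and> on_floor x a \<longleftrightarrow> maxsel y ps \<and> on_floor y a"
  shows "same_tight k x y"
  using assms by (simp add: same_tight_k chain_tight_iff)

lemma push_low: "p \<in> low k \<Longrightarrow> lk (push x) p = lk x p"
  and push_steps: "(a, b) \<in> steps (Suc k) \<Longrightarrow> lk (push x) a = lk x a \<and> lk (push x) b = lk x b"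
  by (simp_all add: push_def transfer_def dual_def overwrite_Y)

text \<open>Speaking of any minimizer, rather than of the one chosen in \<open>push\<close>, keeps
  the description of the image free of choices.\<close>

definition bottom :: "(nat \<times> nat \<Rightarrow>\<^sub>0 real) \<Rightarrow> nat \<times> nat \<Rightarrow> bool" where
  "bottom x c \<longleftrightarrow> (\<forall>c'\<in>W. lk x c \<le> lk x c')"

text \<open>The tight constraints of the image are expressed through \<open>x\<close> alone, so they
  do not depend on the choices made in \<open>push\<close>. A dualized point gives no zeros over
  \<open>Y\<close>, since its upper bound is not attained there.\<close>

lemma push_tight:
  assumes x: "x \<in> P k" "normal x" and a: "a \<in> Y"
  shows "lk (push x) a = 0 \<longleftrightarrow> on_floor x a \<and> \<not> dualized x" (is ?zero)
    and "sel ps \<Longrightarrow> c \<in> W \<Longrightarrow> lk (push x) c = cs ps (push x) + lk (push x) a \<longleftrightarrow>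
      maxsel x ps \<and> (if dualized x then on_floor x a \<and> bottom x c else lk x c = lk x a)"
      (is "_ \<Longrightarrow> _ \<Longrightarrow> ?chain")
proof -
  have "?zero \<and> (sel ps \<longrightarrow> c \<in> W \<longrightarrow> ?chain)"
  proof (cases "dualized x")
    case True
    then obtain b where b: "lowest x b" "push x = dual b x"
      using push_dual x by blast
    have bW: "b \<in> W"
      using b by (simp add: lowest_def)
    have "lk x b \<noteq> lk x a"
      using True a bW by (auto simp: dualized_def top_tight_def)
    moreover have "bottom x c \<longleftrightarrow> lk x c = lk x b" if "c \<in> W"
    proof
      assume "bottom x c"
      then have "lk x c \<le> lk x b" "lk x b \<le> lk x c"
        using bW that b(1) by (auto simp: bottom_def lowest_def)
      then show "lk x c = lk x b"
        by simp
    qed (use b(1) in \<open>auto simp: bottom_def lowest_def\<close>)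
    moreover have "lk x c = cs ps x + (lk x b - lk x a) \<longleftrightarrow> (maxsel x ps \<and> on_floor x a) \<and> lk x c = lk x b"
      if "sel ps" "c \<in> W"
      using dual_chain_iff[OF x(1) b(1)] that a by blast
    ultimately show ?thesis
      using True a bW by (simp add: b(2) dual_def overwrite_Y)
  next
    case False
    then obtain p where p: "maxsel x p" "push x = transfer p x"
      using push_transfer by blast
    have "on_floor x a \<longleftrightarrow> lk x a = cs p x"
      using on_floor_iff[OF x(1) p(1) a] .
    moreover have "lk x c = cs ps x + (lk x a - cs p x) \<longleftrightarrow> maxsel x ps \<and> lk x c = lk x a"
      if "sel ps" "c \<in> W"
      using transfer_chain_iff[OF x(1) p(1)] that a by blast
    ultimately show ?thesis
      using False a by (simp add: p(2) transfer_def overwrite_Y)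
  qed
  then show ?zero "sel ps \<Longrightarrow> c \<in> W \<Longrightarrow> ?chain"
    by blast+
qed

text \<open>The pattern of the image reveals which map was used. If \<open>y\<close> were
  transferred, the absence of zeros over \<open>Y\<close> would leave its floor empty, so normality
  would make its maximal chains canonical. The chain inequalities then give \<open>x\<close> the
  same maximal chains, contradicting that \<open>x\<close> is dualized.\<close>

lemma dualized_push_eq:
  assumes x: "x \<in> P k" "normal x" and y: "y \<in> P k" "normal y"
    and same: "same_tight (Suc k) (push x) (push y)" and dx: "dualized x"
  shows "dualized y"
proof (rule ccontr)
  assume dy: "\<not> dualized y"
  have low: "\<forall>p\<in>low k. lk x p = 0 \<longleftrightarrow> lk y p = 0"
    using same by (simp add: same_tight_Suc push_low)
  have "\<not> on_floor y a" for a
  proof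
    assume f: "on_floor y a"
    then have "a \<in> Y"
      by (simp add: on_floor_def)
    with same have "lk (push x) a = 0 \<longleftrightarrow> lk (push y) a = 0"
      by (simp add: same_tight_Suc)
    with f dx dy \<open>a \<in> Y\<close> show False
      by (simp add: push_tight x y)
  qed
  then have "\<not> bot_tight y"
    unfolding bot_tight_def by blast
  then have cy: "canonical_max y"
    using y by (simp add: normal_def)
  have chain: "maxsel x ps \<and> on_floor x a \<and> bottom x c \<longleftrightarrow> maxsel y ps \<and> lk y c = lk y a"
    if "sel ps" "a \<in> Y" "c \<in> W" for ps a c
    using same that dx dy push_tight(2)[OF x that(2,1,3)] push_tight(2)[OF y that(2,1,3)]
    by (simp add: same_tight_Suc)
  obtain a where a: "on_floor x a" "a \<in> Y"
    using dx unfolding dualized_def bot_tight_def on_floor_def by blast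
  obtain c where c: "c \<in> W" "bottom x c"
    using finite_argmin[OF finite_rk W_nonempty, of "lk x"] unfolding bottom_def by metis
  obtain p where p: "maxsel x p"
    using maxsel_exists by blast
  \<comment> \<open>One tight chain inequality of the image of \<open>x\<close> shows that the pair
    \<open>a\<close>, \<open>c\<close> is tight for \<open>y\<close>; at this pair the pattern lists
    exactly the maximal chains on both sides.\<close>
  then have "lk y c = lk y a"
    using chain[of p a c] a c by (simp add: maxsel_def)
  then have "maxsel x ps \<longleftrightarrow> maxsel y ps" for ps
    using chain[of ps a c] a c by (auto simp: maxsel_def)
  then have "canonical_max x"
    using canonical_max_transport[OF cy, of x] low by simp
  with dx show False
    by (simp add: dualized_def)
qed

text \<open>Both points use the same map. For \<open>dual\<close> the products of maximal chains and
  floor are read off at a minimizer over \<open>W\<close>. For \<open>transfer\<close> the zeros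
  give the floor, and the maximal chains come from a tight pair with \<open>W\<close> or else from
  canonicity.\<close>

lemma same_tight_push_imp:
  assumes x: "x \<in> P k" "normal x" and y: "y \<in> P k" "normal y"
    and same: "same_tight (Suc k) (push x) (push y)"
  shows "same_tight k x y"
proof (rule same_tight_kI[OF x(1) y(1)])
  have same': "same_tight (Suc k) (push y) (push x)"
    using same by (simp add: same_tight_def)
  have d: "dualized x \<longleftrightarrow> dualized y"
    using dualized_push_eq[OF x y same] dualized_push_eq[OF y x same'] by blast
  show low: "\<forall>p\<in>low k. lk x p = 0 \<longleftrightarrow> lk y p = 0"
    using same by (simp add: same_tight_Suc push_low)
  show "\<forall>(a, b)\<in>steps (Suc k). lk x b = lk x a \<longleftrightarrow> lk y b = lk y a"
    using same push_steps by (fastforce simp: same_tight_Suc)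
  have zero: "on_floor x a \<longleftrightarrow> on_floor y a" if "a \<in> Y" "\<not> dualized x" for a
    using same that d push_tight(1)[OF x that(1)] push_tight(1)[OF y that(1)]
    by (simp add: same_tight_Suc)
  have chain: "maxsel x ps \<and> (if dualized x then on_floor x a \<and> bottom x c else lk x c = lk x a)
    \<longleftrightarrow> maxsel y ps \<and> (if dualized x then on_floor y a \<and> bottom y c else lk y c = lk y a)"
    if "sel ps" "a \<in> Y" "c \<in> W" for ps a c
    using same that d push_tight(2)[OF x that(2,1,3)] push_tight(2)[OF y that(2,1,3)]
    by (simp add: same_tight_Suc)
  obtain p q where p: "maxsel x p" and q: "maxsel y q"
    using maxsel_exists by metis
  then have s: "sel p" "sel q"
    by (auto simp: maxsel_def)
  \<comment> \<open>The minimizers for \<open>x\<close> and \<open>y\<close> may differ; each serves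
    one direction of the equivalence, as do \<open>p\<close> and \<open>q\<close>.\<close>
  obtain c0 c1 where c: "c0 \<in> W" "bottom x c0" "c1 \<in> W" "bottom y c1"
    using finite_argmin[OF finite_rk W_nonempty] unfolding bottom_def by metis
  show top: "lk x c = lk x a \<longleftrightarrow> lk y c = lk y a" if "a \<in> Y" "c \<in> W" for a c
  proof (cases "dualized x")
    case True
    \<comment> \<open>Both points are dualized, so neither has a tight pair and both sides are
      false.\<close>
    with d that show ?thesis
      unfolding dualized_def top_tight_def by blast
  next
    case False
    with p q chain[OF s(1) that] chain[OF s(2) that] show ?thesis
      by auto
  qed
  show "maxsel x ps \<and> on_floor x a \<longleftrightarrow> maxsel y ps \<and> on_floor y a"
    if "sel ps" "a \<in> Y" for ps a
  proof (cases "dualized x")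
    case True
    with c chain[OF that c(1)] chain[OF that c(3)] show ?thesis
      by auto
  next
    case nd: False
    \<comment> \<open>The floors agree by \<open>zero\<close>, so the selections need comparing only
      when \<open>a\<close> is on both.\<close>
    have "maxsel x ps \<longleftrightarrow> maxsel y ps" if f: "on_floor x a" "on_floor y a"
    proof (cases "top_tight x")
      case True
      then obtain a' c' where "a' \<in> Y" "c' \<in> W" "lk x c' = lk x a'"
        unfolding top_tight_def by blast
      with nd top[of a' c'] chain[OF \<open>sel ps\<close>, of a' c'] show ?thesis
        by simp
    next
      case False
      then have "\<not> top_tight y"
        using top unfolding top_tight_def by blast
      moreover have "bot_tight x" "bot_tight y"
        using f unfolding bot_tight_def by blast+
      ultimately have "canonical_max x" "canonical_max y"
        using nd d False by (auto simp: dualized_def)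
      then show ?thesis
        using canonical_max_eq low by blast
    qed
    with zero[OF \<open>a \<in> Y\<close> nd] show ?thesis
      by blast
  qed
qed

section \<open>From points back to faces\<close>

lemma face_eq_iff:
  assumes "x \<in> P j" "y \<in> P j"
  shows "face j x = face j y \<longleftrightarrow> same_tight j x y"
  using tight_face_eq_iff[OF assms] by (simp add: same_tight_def)

text \<open>The bound on \<open>i\<close> excludes the empty face, so the face is the tight face of
  some point, and normalizing that point keeps the face.\<close>

lemma normal_face_representative:
  assumes "F \<in> faces_of_codim tau k i" "i \<le> sum_list tau"
  obtains x where "x \<in> P k" "normal x" "F = face k x"
proof -
  have F: "F face_of P k" "int (sum_list tau) - affdim F = int i"
    using assms by (auto simp: faces_of_codim_def chain_order_polytope_eq)
  then have "F \<noteq> {}"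
    using assms(2) by (auto simp: affdim_empty)
  then obtain x where x: "x \<in> P k" "F = face k x"
    using face_of_polyhedron_in_tight[OF affine_affspace finite_slacks _ F(1)] affine_fun_slacks
    by metis
  obtain y where "y \<in> P k" "same_tight k x y" "normal y"
    using normalize[OF x(1)] .
  then show thesis
    using that[of y] x face_eq_iff by simp
qed

text \<open>The map on faces goes through one fixed normal representative per face; recovering the
  pattern of the representative recovers the face.\<close>

lemma faces_of_codim_injection:
  assumes "i \<le> sum_list tau"
  shows "\<exists>f. inj_on f (faces_of_codim tau k i)
    \<and> f ` faces_of_codim tau k i \<subseteq> faces_of_codim tau (Suc k) i"
proof -
  have "\<exists>r. \<forall>F\<in>faces_of_codim tau k i. r F \<in> P k \<and> normal (r F) \<and> F = face k (r F)"
    using normal_face_representative[OF _ assms] by (intro bchoice) metis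
  then obtain r where r: "\<And>F. F \<in> faces_of_codim tau k i \<Longrightarrow> r F \<in> P k \<and> normal (r F) \<and> F = face k (r F)"
    by blast
  show ?thesis
  proof (intro exI[of _ "\<lambda>F. face (Suc k) (push (r F))"] conjI inj_onI image_subsetI)
    fix F
    assume F: "F \<in> faces_of_codim tau k i"
    have "face (Suc k) (push (r F)) face_of chain_order_polytope tau (Suc k)"
      unfolding chain_order_polytope_eq
      by (intro tight_face_face_of affine_affspace affine_fun_slacks)
    moreover have "affdim (face (Suc k) (push (r F))) = affdim F"
      using affdim_push r[OF F] by metis
    ultimately show "face (Suc k) (push (r F)) \<in> faces_of_codim tau (Suc k) i"
      using F by (simp add: faces_of_codim_def)
  next
    fix F G
    assume F: "F \<in> faces_of_codim tau k i" and G: "G \<in> faces_of_codim tau k i"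
      and "face (Suc k) (push (r F)) = face (Suc k) (push (r G))"
    then have "same_tight (Suc k) (push (r F)) (push (r G))"
      using r push_mem by (simp add: face_eq_iff)
    then have "same_tight k (r F) (r G)"
      using r[OF F] r[OF G] same_tight_push_imp by blast
    then show "F = G"
      using r[OF F] r[OF G] face_eq_iff by metis
  qed
qed

end

theorem theorem4p1:
  fixes tau :: "nat list" and k i :: nat
  assumes "\<forall>t \<in> set tau. 0 < t"
    and "k + 1 \<le> length tau"
    and "2 \<le> i" and "i \<le> sum_list tau"
  shows "\<exists>f. inj_on f (faces_of_codim tau k i) \<and>
             f ` faces_of_codim tau k i \<subseteq> faces_of_codim tau (k + 1) i"
proof -
  interpret rank_step tau k
    using assms by unfold_locales auto
  show ?thesis
    using faces_of_codim_injection[OF assms(4)] by simp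
qed

end
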